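(* Let $\Omega\subset\mathbb{H}$ be a symmetric slice domain such that $\Omega\cap\mathbb{C}_{I}$ is simply connected for one (and then any) $I\in\mathbb{S}$. Let $I_0,M_0\in\mathbb{S}$, let $h=h_0+h_1M_0\in\mathcal{S}_{M_{0}}(\Omega)\setminus\mathcal{S}_{\mathbb{R}}(\Omega)$ with $h_0,h_1\in\mathcal{S}_{\mathbb{R}}(\Omega)$, and let $g\in\mathcal{S}(\Omega)$. If $I_0,M_0$ are linearly independent, set $K_0=\frac{I_0\wedge M_0}{|I_0\wedge M_0|}$, $J_0=K_0I_0$, write $M_0=aI_0+bJ_0$ (where $b>0$, $a^2+b^2=1$), and write $g=g_{0}+g_{1}I_{0}+g_{2}J_{0}+g_{3}K_{0}$ with $g_0,g_1,g_2,g_3\in\mathcal{S}_{\mathbb{R}}(\Omega)$. Then there exists $f\in\mathcal{S}_{I_{0}}(\Omega)$ such that $g=h*f*h^{c}$ if and only if (i) in the case $\mathbb{C}_{M_{0}}=\mathbb{C}_{I_{0}}$: $g\in\mathcal{S}_{I_{0}}(\Omega)$ and $h^{s}$ divides $g$; (ii) in the case $\mathbb{C}_{M_{0}}\neq\mathbb{C}_{I_{0}}$ and $M_{0}\not\perp I_{0}$: $h^{s}$ divides $g_{0}$, $h_{0}^{2}+(2a^{2}-1)h_{1}^{2}$ divides $g_{1}$, $h_{1}^{2}$ divides $g_{2}$, $h_{0}h_{1}$ divides $g_{3}$, and $$h_{0}g_{2}+ah_{1}g_{3}=0,\qquad (h_{0}^{2}+(2a^{2}-1)h_{1}^{2})g_{2}=2abh_{1}^{2}g_{1};$$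 (iii) in the case $M_{0}\perp I_{0}$: $h^{s}$ divides $g_{0}$, $h_{0}^{2}-h_{1}^{2}$ divides $g_{1}$, $h_{0}h_{1}$ divides $g_{3}$, $g_{2}\equiv 0$ and $$2h_{0}h_{1}g_{1}+(h_{0}^{2}-h_{1}^{2})g_{3}=0.$$
   Context: $\mathbb{H}$ is the algebra of quaternions with standard basis $1,i,j,k$, $\mathrm{Im}\,\mathbb{H}=\mathrm{Span}_{\mathbb{R}}(i,j,k)\simeq\mathbb{R}^3$ (Euclidean, with cross product $\wedge$), $\mathbb{S}=\{q\in\mathbb{H}: q^2=-1\}\subset\mathrm{Im}\,\mathbb{H}$, and $\mathbb{C}_I=\mathrm{Span}_{\mathbb{R}}(1,I)$ for $I\in\mathbb{S}$. A symmetric slice domain $\Omega\subset\mathbb{H}$ is a domain (connected open set) such that $\Omega\cap\mathbb{R}\neq\emptyset$ and, whenever $\alpha+I\beta\in\Omega$ ($\alpha,\beta\in\mathbb{R}$, $I\in\mathbb{S}$), also $\alpha+J\beta\in\Omega$ for all $J\in\mathbb{S}$. A function $f:\Omega\to\mathbb{H}$ is slice regular if for every $J\in\mathbb{S}$ the restriction $f_J$ of $f$ to $\Omega\cap\mathbb{C}_J$ is holomorphic: $\frac12\left(\frac{\partial}{\partial\alpha}+J\frac{\partial}{\partial\beta}\right)f_J(\alpha+J\beta)\equiv0$. $\mathcal{S}(\Omega)$ is the set of slice regular functions on $\Omega$; $\mathcal{S}_{\mathbb{R}}(\Omega)$ is the subset of slice preserving functions, i.e. $f(\Omega\cap\mathbb{C}_I)\subset\mathbb{C}_I$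 for all $I\in\mathbb{S}$; $\mathcal{S}_{J}(\Omega)$ is the set of $f\in\mathcal{S}(\Omega)$ with $f(\Omega\cap\mathbb{C}_J)\subset\mathbb{C}_J$. Known facts: for any basis $1,I_0,J_0,K_0$ of $\mathbb{H}$ every $f\in\mathcal{S}(\Omega)$ is written uniquely as $f=f_0+f_1I_0+f_2J_0+f_3K_0$ with $f_0,\dots,f_3\in\mathcal{S}_{\mathbb{R}}(\Omega)$, and if $I_0\in\mathbb{S}$ then $f\in\mathcal{S}_{I_0}(\Omega)$ iff $f_2\equiv f_3\equiv0$. With respect to $1,i,j,k$, the regular conjugate is $f^c=f_0-f_1i-f_2j-f_3k$ and the $*$-product is $f*g=f_0g_0-f_1g_1-f_2g_2-f_3g_3+f_0(g_1i+g_2j+g_3k)+g_0(f_1i+f_2j+f_3k)+(f_2g_3-f_3g_2)i+(f_3g_1-f_1g_3)j+(f_1g_2-f_2g_1)k$ (pointwise products); it is associative. The symmetrized function is $h^s=h*h^c$, which equals $h_0^2+h_1^2$ for $h=h_0+h_1M_0$. For $\sigma,\tau\in\mathcal{S}_{\mathbb{R}}(\Omega)$, $\sigma$ divides $\tau$ if $\tau=\sigma\kappa$ with $\kappa\in\mathcal{S}_{\mathbb{R}}(\Omega)$; $\sigma\in\mathcal{S}_{\mathbb{R}}(\Omega)$ divides $g\in\mathcal{S}(\Omega)$ if $g=\sigma\kappa$ with $\kappa\in\mathcal{S}(\Omega)$. *)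

theory Defs
  imports "HOL-Analysis.Analysis"
begin

datatype quat = Quat (qRe: real) (qI: real) (qJ: real) (qK: real)

lemma quat_eq_iff: "x = y \<longleftrightarrow> qRe x = qRe y \<and> qI x = qI y \<and> qJ x = qJ y \<and> qK x = qK y"
  by (cases x, cases y) simp

definition quat_i :: quat where "quat_i = Quat 0 1 0 0"
definition quat_j :: quat where "quat_j = Quat 0 0 1 0"
definition quat_k :: quat where "quat_k = Quat 0 0 0 1"

lemma quat_units_sel [simp]:
  "qRe quat_i = 0" "qI quat_i = 1" "qJ quat_i = 0" "qK quat_i = 0"
  "qRe quat_j = 0" "qI quat_j = 0" "qJ quat_j = 1" "qK quat_j = 0"
  "qRe quat_k = 0" "qI quat_k = 0" "qJ quat_k = 0" "qK quat_k = 1"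
  by (simp_all add: quat_i_def quat_j_def quat_k_def)

instantiation quat :: real_div_algebra
begin

definition zero_quat_def: "0 = Quat 0 0 0 0"
definition one_quat_def: "1 = Quat 1 0 0 0"
definition plus_quat_def:
  "x + y = Quat (qRe x + qRe y) (qI x + qI y) (qJ x + qJ y) (qK x + qK y)"
definition uminus_quat_def: "- x = Quat (- qRe x) (- qI x) (- qJ x) (- qK x)"
definition minus_quat_def:
  "x - y = Quat (qRe x - qRe y) (qI x - qI y) (qJ x - qJ y) (qK x - qK y)"
definition times_quat_def:
  "x * y = Quat
     (qRe x * qRe y - qI x * qI y - qJ x * qJ y - qK x * qK y)
     (qRe x * qI y + qI x * qRe y + qJ x * qK y - qK x * qJ y)
     (qRe x * qJ y - qI x * qK y + qJ x * qRe y + qK x * qI y)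
     (qRe x * qK y + qI x * qJ y - qJ x * qI y + qK x * qRe y)"
definition scaleR_quat_def: "scaleR r x = Quat (r * qRe x) (r * qI x) (r * qJ x) (r * qK x)"
definition inverse_quat_def:
  "inverse x = (let n = (qRe x)\<^sup>2 + (qI x)\<^sup>2 + (qJ x)\<^sup>2 + (qK x)\<^sup>2
     in Quat (qRe x / n) (- qI x / n) (- qJ x / n) (- qK x / n))"
definition divide_quat_def: "(x::quat) div y = x * inverse y"

lemmas quat_defs = zero_quat_def one_quat_def plus_quat_def uminus_quat_def minus_quat_def
  times_quat_def scaleR_quat_def

lemma quat_sumsq_eq_0_iff:
  "(qRe x)\<^sup>2 + (qI x)\<^sup>2 + (qJ x)\<^sup>2 + (qK x)\<^sup>2 = 0 \<longleftrightarrow> x = 0"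
proof -
  have "(qRe x)\<^sup>2 + (qI x)\<^sup>2 + (qJ x)\<^sup>2 + (qK x)\<^sup>2 = 0 \<longleftrightarrow>
      ((qRe x)\<^sup>2 + (qI x)\<^sup>2) + ((qJ x)\<^sup>2 + (qK x)\<^sup>2) = 0"
    by (simp add: add.assoc)
  also have "\<dots> \<longleftrightarrow> (qRe x)\<^sup>2 + (qI x)\<^sup>2 = 0 \<and> (qJ x)\<^sup>2 + (qK x)\<^sup>2 = 0"
    by (intro add_nonneg_eq_0_iff) auto
  finally show ?thesis
    by (simp add: sum_power2_eq_zero_iff quat_eq_iff zero_quat_def)
qed

instance
proof
  fix x y z :: quat and r s :: real
  show "x + y + z = x + (y + z)" "x + y = y + x" "0 + x = x" "- x + x = 0" "x - y = x + - y"
    by (simp_all add: quat_defs)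
  show "x * y * z = x * (y * z)" "(x + y) * z = x * z + y * z" "x * (y + z) = x * y + x * z"
    by (simp_all add: quat_defs algebra_simps)
  show "1 * x = x" "x * 1 = x" "(0::quat) \<noteq> 1"
    by (simp_all add: quat_defs)
  show "r *\<^sub>R (x + y) = r *\<^sub>R x + r *\<^sub>R y" "(r + s) *\<^sub>R x = r *\<^sub>R x + s *\<^sub>R x"
    "r *\<^sub>R s *\<^sub>R x = (r * s) *\<^sub>R x" "1 *\<^sub>R x = x"
    "r *\<^sub>R x * y = r *\<^sub>R (x * y)" "x * r *\<^sub>R y = r *\<^sub>R (x * y)"
    by (simp_all add: quat_defs algebra_simps)
  show "inverse 0 = (0::quat)"
    by (simp add: inverse_quat_def zero_quat_def)
  show "x div y = x * inverse y"
    by (rule divide_quat_def)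
  assume "x \<noteq> 0"
  define n where "n = (qRe x)\<^sup>2 + (qI x)\<^sup>2 + (qJ x)\<^sup>2 + (qK x)\<^sup>2"
  with \<open>x \<noteq> 0\<close> have n: "n \<noteq> 0"
    by (simp add: quat_sumsq_eq_0_iff)
  have inv: "inverse x = (1 / n) *\<^sub>R Quat (qRe x) (- qI x) (- qJ x) (- qK x)"
    by (simp add: inverse_quat_def Let_def n_def scaleR_quat_def)
  have "Quat (qRe x) (- qI x) (- qJ x) (- qK x) * x = n *\<^sub>R 1"
    "x * Quat (qRe x) (- qI x) (- qJ x) (- qK x) = n *\<^sub>R 1"
    by (simp_all add: times_quat_def one_quat_def scaleR_quat_def n_def power2_eq_square)
  moreover have "r *\<^sub>R u * v = r *\<^sub>R (u * v)" "u * r *\<^sub>R v = r *\<^sub>R (u * v)" for r and u v :: quat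
    by (simp_all add: quat_defs algebra_simps)
  ultimately show "inverse x * x = 1" "x * inverse x = 1"
    using n by (simp_all add: inv) (simp_all add: scaleR_quat_def one_quat_def)
qed

end

lemma quat_sel_simps [simp]:
  "qRe 0 = 0" "qI 0 = 0" "qJ 0 = 0" "qK 0 = 0"
  "qRe 1 = 1" "qI 1 = 0" "qJ 1 = 0" "qK 1 = 0"
  "qRe (x + y) = qRe x + qRe y" "qI (x + y) = qI x + qI y"
  "qJ (x + y) = qJ x + qJ y" "qK (x + y) = qK x + qK y"
  "qRe (- x) = - qRe x" "qI (- x) = - qI x" "qJ (- x) = - qJ x" "qK (- x) = - qK x"
  "qRe (x - y) = qRe x - qRe y" "qI (x - y) = qI x - qI y"
  "qJ (x - y) = qJ x - qJ y" "qK (x - y) = qK x - qK y"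
  "qRe (r *\<^sub>R x) = r * qRe x" "qI (r *\<^sub>R x) = r * qI x"
  "qJ (r *\<^sub>R x) = r * qJ x" "qK (r *\<^sub>R x) = r * qK x"
  by (simp_all add: quat_defs)

instantiation quat :: real_inner
begin

definition inner_quat_def:
  "inner x y = qRe x * qRe y + qI x * qI y + qJ x * qJ y + qK x * qK y"
definition norm_quat_def: "norm (x::quat) = sqrt (inner x x)"
definition sgn_quat_def: "sgn (x::quat) = x /\<^sub>R norm x"
definition dist_quat_def: "dist (x::quat) y = norm (x - y)"
definition uniformity_quat_def [code del]:
  "(uniformity :: (quat \<times> quat) filter) = (INF e\<in>{0<..}. principal {(x, y). dist x y < e})"
definition open_quat_def [code del]:
  "open (U :: quat set) \<longleftrightarrow> (\<forall>x\<in>U. eventually (\<lambda>(x', y). x' = x \<longrightarrow> y \<in> U) uniformity)"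

instance
proof
  fix x y z :: quat and r :: real and U :: "quat set"
  show "inner x y = inner y x" "inner (x + y) z = inner x z + inner y z"
    "inner (r *\<^sub>R x) y = r * inner x y"
    by (simp_all add: inner_quat_def algebra_simps)
  show "0 \<le> inner x x"
    by (simp add: inner_quat_def)
  show "inner x x = 0 \<longleftrightarrow> x = 0"
    using quat_sumsq_eq_0_iff[of x] by (simp add: inner_quat_def power2_eq_square)
qed (rule norm_quat_def sgn_quat_def dist_quat_def uniformity_quat_def open_quat_def)+

end

instance quat :: real_normed_div_algebra
proof
  fix x y :: quat
  have "inner (x * y) (x * y) = inner x x * inner y y"
    by (simp only: inner_quat_def times_quat_def quat.sel) algebra
  then show "norm (x * y) = norm x * norm y"
    by (simp add: norm_quat_def real_sqrt_mult)
qed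

instantiation quat :: euclidean_space
begin

definition Basis_quat_def: "Basis = {1, quat_i, quat_j, quat_k}"

instance
proof
  fix u v x :: quat
  show "(Basis :: quat set) \<noteq> {}" "finite (Basis :: quat set)"
    by (simp_all add: Basis_quat_def)
  show "(\<forall>u\<in>Basis. inner x u = 0) \<longleftrightarrow> x = 0"
    by (simp add: Basis_quat_def inner_quat_def quat_eq_iff[of x])
  assume "u \<in> Basis" "v \<in> Basis"
  then show "inner u v = (if u = v then 1 else 0)"
    unfolding Basis_quat_def by (elim insertE emptyE) (simp_all add: inner_quat_def quat_eq_iff)
qed

end

definition quat_Im :: "quat \<Rightarrow> real ^ 3" where
  "quat_Im q = vector [qI q, qJ q, qK q]"

definition quat_of_Im :: "real ^ 3 \<Rightarrow> quat" where
  "quat_of_Im v = Quat 0 (v $ 1) (v $ 2) (v $ 3)"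

definition quat_wedge :: "quat \<Rightarrow> quat \<Rightarrow> quat"  (infixl "\<and>\<^sub>H" 70) where
  "p \<and>\<^sub>H q = quat_of_Im (cross3 (quat_Im p) (quat_Im q))"

definition imag_sphere :: "quat set"  ("\<S>") where
  "\<S> = {q. q\<^sup>2 = - 1}"

definition slice_plane :: "quat \<Rightarrow> quat set"  ("\<C>") where
  "\<C> I = span {1, I}"

definition symmetric_slice_domain :: "quat set \<Rightarrow> bool" where
  "symmetric_slice_domain \<Omega> \<longleftrightarrow>
     open \<Omega> \<and> connected \<Omega> \<and> \<Omega> \<inter> \<real> \<noteq> {} \<and>
     (\<forall>\<alpha> \<beta>. \<forall>I\<in>\<S>. \<forall>J\<in>\<S>. of_real \<alpha> + \<beta> *\<^sub>R I \<in> \<Omega> \<longrightarrow> of_real \<alpha> + \<beta> *\<^sub>R J \<in> \<Omega>)"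

text \<open>A function on \<open>\<Omega>\<close> is represented by a total function whose values outside
  \<open>\<Omega>\<close> are irrelevant: as \<open>\<Omega>\<close> is open, all notions below depend only on the values
  on \<open>\<Omega>\<close>, and functions are compared on \<open>\<Omega>\<close> only. Holomorphy of a restriction to a slice
  means real (Frechet) differentiability together with the Cauchy-Riemann equation.\<close>

definition slice_regular :: "quat set \<Rightarrow> (quat \<Rightarrow> quat) set" where
  "slice_regular \<Omega> = {f. \<forall>J\<in>\<S>. \<forall>\<alpha> \<beta>. of_real \<alpha> + \<beta> *\<^sub>R J \<in> \<Omega> \<longrightarrow>
     (\<lambda>(x, y). f (of_real x + y *\<^sub>R J)) differentiable at (\<alpha>, \<beta>) \<and>
     (1/2) *\<^sub>R (vector_derivative (\<lambda>x. f (of_real x + \<beta> *\<^sub>R J)) (at \<alpha>)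
        + J * vector_derivative (\<lambda>y. f (of_real \<alpha> + y *\<^sub>R J)) (at \<beta>)) = 0}"

definition slice_preserving :: "quat set \<Rightarrow> (quat \<Rightarrow> quat) set" where
  "slice_preserving \<Omega> = {f \<in> slice_regular \<Omega>. \<forall>I\<in>\<S>. f ` (\<Omega> \<inter> \<C> I) \<subseteq> \<C> I}"

definition one_slice_preserving :: "quat set \<Rightarrow> quat \<Rightarrow> (quat \<Rightarrow> quat) set" where
  "one_slice_preserving \<Omega> J = {f \<in> slice_regular \<Omega>. f ` (\<Omega> \<inter> \<C> J) \<subseteq> \<C> J}"

definition slice_decomp ::
  "quat set \<Rightarrow> quat \<Rightarrow> quat \<Rightarrow> quat \<Rightarrow> (quat \<Rightarrow> quat) \<Rightarrow>
   (quat \<Rightarrow> quat) \<Rightarrow> (quat \<Rightarrow> quat) \<Rightarrow> (quat \<Rightarrow> quat) \<Rightarrow> (quat \<Rightarrow> quat) \<Rightarrow> bool" where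
  "slice_decomp \<Omega> I J K f f0 f1 f2 f3 \<longleftrightarrow>
     f0 \<in> slice_preserving \<Omega> \<and> f1 \<in> slice_preserving \<Omega> \<and>
     f2 \<in> slice_preserving \<Omega> \<and> f3 \<in> slice_preserving \<Omega> \<and>
     (\<forall>q\<in>\<Omega>. f q = f0 q + f1 q * I + f2 q * J + f3 q * K)"

text \<open>On a symmetric slice domain, every slice regular function has such a decomposition with
  respect to the standard basis, and its components are unique on \<open>\<Omega>\<close>; hence the choice below
  only affects values outside \<open>\<Omega>\<close>.\<close>

definition slice_components ::
  "quat set \<Rightarrow> (quat \<Rightarrow> quat) \<Rightarrow>
   (quat \<Rightarrow> quat) \<times> (quat \<Rightarrow> quat) \<times> (quat \<Rightarrow> quat) \<times> (quat \<Rightarrow> quat)" where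
  "slice_components \<Omega> f =
     (SOME (f0, f1, f2, f3). slice_decomp \<Omega> quat_i quat_j quat_k f f0 f1 f2 f3)"

definition regular_conj :: "quat set \<Rightarrow> (quat \<Rightarrow> quat) \<Rightarrow> quat \<Rightarrow> quat" where
  "regular_conj \<Omega> f = (case slice_components \<Omega> f of (f0, f1, f2, f3) \<Rightarrow>
     (\<lambda>q. f0 q - f1 q * quat_i - f2 q * quat_j - f3 q * quat_k))"

definition star_prod ::
  "quat set \<Rightarrow> (quat \<Rightarrow> quat) \<Rightarrow> (quat \<Rightarrow> quat) \<Rightarrow> quat \<Rightarrow> quat" where
  "star_prod \<Omega> f g =
     (case slice_components \<Omega> f of (f0, f1, f2, f3) \<Rightarrow>
      case slice_components \<Omega> g of (g0, g1, g2, g3) \<Rightarrow>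
      (\<lambda>q. f0 q * g0 q - f1 q * g1 q - f2 q * g2 q - f3 q * g3 q
         + f0 q * (g1 q * quat_i + g2 q * quat_j + g3 q * quat_k)
         + g0 q * (f1 q * quat_i + f2 q * quat_j + f3 q * quat_k)
         + (f2 q * g3 q - f3 q * g2 q) * quat_i
         + (f3 q * g1 q - f1 q * g3 q) * quat_j
         + (f1 q * g2 q - f2 q * g1 q) * quat_k))"

definition symmetrized :: "quat set \<Rightarrow> (quat \<Rightarrow> quat) \<Rightarrow> quat \<Rightarrow> quat" where
  "symmetrized \<Omega> h = star_prod \<Omega> h (regular_conj \<Omega> h)"

definition divides_preserving ::
  "quat set \<Rightarrow> (quat \<Rightarrow> quat) \<Rightarrow> (quat \<Rightarrow> quat) \<Rightarrow> bool" where
  "divides_preserving \<Omega> \<sigma> \<tau> \<longleftrightarrow> (\<exists>\<kappa>\<in>slice_preserving \<Omega>. \<forall>q\<in>\<Omega>. \<tau> q = \<sigma> q * \<kappa> q)"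

definition divides_regular ::
  "quat set \<Rightarrow> (quat \<Rightarrow> quat) \<Rightarrow> (quat \<Rightarrow> quat) \<Rightarrow> bool" where
  "divides_regular \<Omega> \<sigma> g \<longleftrightarrow> (\<exists>\<kappa>\<in>slice_regular \<Omega>. \<forall>q\<in>\<Omega>. g q = \<sigma> q * \<kappa> q)"

end

theory Submission
  imports Defs "HOL-Complex_Analysis.Conformal_Mappings"
begin

text \<open>Slice regular functions that agree near one real point agree everywhere, slice preserving
  functions take real values on the real axis, and there the regular product is the pointwise
  quaternion product. Hence every identity between regular products may be checked at real points.
  In the basis adapted to \<open>I\<^sub>0\<close> and \<open>M\<^sub>0\<close> the product \<open>h f h\<^sup>c\<close>, with \<open>f = f\<^sub>0 + f\<^sub>1 I\<^sub>0\<close>, has components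
  \<open>h\<^sup>s f\<^sub>0\<close>, \<open>(h\<^sub>0\<^sup>2 + (2a\<^sup>2 - 1) h\<^sub>1\<^sup>2) f\<^sub>1\<close>, \<open>2ab h\<^sub>1\<^sup>2 f\<^sub>1\<close> and \<open>-2b h\<^sub>0 h\<^sub>1 f\<^sub>1\<close>. Conversely, the divisibility
  conditions produce \<open>f\<^sub>0\<close> and \<open>f\<^sub>1\<close>, and the two relations, after cancelling a factor that does not
  vanish identically, say that the same \<open>f\<^sub>1\<close> serves all three imaginary components.\<close>

section \<open>Slice regularity on complex planes\<close>

text \<open>The obstacle is that away from the real axis neither the regular product nor the
  comparison of coefficients is pointwise: values of slice preserving functions need not commute
  there with \<open>I0\<close>, \<open>J0\<close>, \<open>K0\<close>. Computations are therefore
  made with real numbers on the axis. The way back requires functions already known to be slice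
  regular, so components are built by complex analysis: a holomorphic coordinate on one slice,
  averaged with its mirror image, extends to a slice preserving function. Which factor can be
  cancelled depends on the units. As \<open>h\<close> is not slice preserving, \<open>h1\<close> is
  not identically zero, so for nonzero \<open>a\<close> and \<open>b\<close> the component
  \<open>g2\<close> determines \<open>f1\<close>. In the perpendicular position the coefficient
  \<open>2 * a * b\<close> is zero, while \<open>h0 * h1\<close> or \<open>h0^2 - h1^2\<close> may
  vanish identically, so \<open>f1\<close> has to be read off from whichever of \<open>g1\<close>
  and \<open>g3\<close> still carries it. When the two planes coincide, \<open>h\<close> and
  \<open>f\<close> commute on the axis, and what remains is to find a quotient by \<open>h^s\<close>
  that preserves the slice of \<open>I0\<close>.\<close>

lemma imag_sphere_iff: "J \<in> \<S> \<longleftrightarrow> qRe J = 0 \<and> (qI J)\<^sup>2 + (qJ J)\<^sup>2 + (qK J)\<^sup>2 = 1"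
proof
  assume "J \<in> \<S>"
  then have e: "J * J = - 1"
    by (simp add: imag_sphere_def power2_eq_square)
  have "qRe J * qI J = 0" "qRe J * qJ J = 0" "qRe J * qK J = 0"
    and r: "qRe J * qRe J - qI J * qI J - qJ J * qJ J - qK J * qK J = - 1"
    using e by (auto simp: quat_eq_iff times_quat_def)
  \<comment> \<open>A nonzero real part would kill the three imaginary parts, and \<open>r\<close>
    would make a real square equal to -1.\<close>
  then have "qRe J = 0"
    by (smt (verit, best) mult_eq_0_iff zero_le_square)
  with r show "qRe J = 0 \<and> (qI J)\<^sup>2 + (qJ J)\<^sup>2 + (qK J)\<^sup>2 = 1"
    by (simp add: power2_eq_square)
next
  assume "qRe J = 0 \<and> (qI J)\<^sup>2 + (qJ J)\<^sup>2 + (qK J)\<^sup>2 = 1"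
  then show "J \<in> \<S>"
    by (simp add: imag_sphere_def power2_eq_square quat_eq_iff times_quat_def)
qed

lemma imag_sphere_square: "J \<in> \<S> \<Longrightarrow> J * J = - 1"
  by (simp add: imag_sphere_def power2_eq_square)

lemma imag_sphere_square_mult: "J \<in> \<S> \<Longrightarrow> J * (J * q) = - q"
  by (simp add: imag_sphere_square flip: mult.assoc)

lemma norm_imag_sphere: "J \<in> \<S> \<Longrightarrow> norm J = 1"
  by (simp add: imag_sphere_iff norm_quat_def inner_quat_def power2_eq_square)

lemma quat_i_in_imag_sphere: "quat_i \<in> \<S>" and quat_j_in_imag_sphere: "quat_j \<in> \<S>"
  by (simp_all add: imag_sphere_iff)

lemma of_real_quat_sel [simp]:
  "qRe (of_real r) = r" "qI (of_real r) = 0" "qJ (of_real r) = 0" "qK (of_real r) = 0"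
  by (simp_all add: of_real_def)

text \<open>For a unit \<open>J\<close> this is the field isomorphism from the complex numbers onto
  the slice plane of \<open>J\<close>; replacing \<open>J\<close> by \<open>- J\<close> conjugates
  the argument. It carries complex analysis to each slice.\<close>

definition slice_emb :: "quat \<Rightarrow> complex \<Rightarrow> quat" where
  "slice_emb J z = of_real (Re z) + Im z *\<^sub>R J"

lemma slice_emb_of_real [simp]: "slice_emb J (of_real x) = of_real x"
  by (simp add: slice_emb_def)

lemma slice_emb_mult: "J \<in> \<S> \<Longrightarrow> slice_emb J (z * w) = slice_emb J z * slice_emb J w"
  by (simp add: slice_emb_def algebra_simps imag_sphere_square)
    (simp add: of_real_def mult.commute)

lemma slice_emb_commute: "J \<in> \<S> \<Longrightarrow> slice_emb J z * slice_emb J w = slice_emb J w * slice_emb J z"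
  by (metis mult.commute slice_emb_mult)

lemma bounded_linear_slice_emb: "bounded_linear (slice_emb J)"
proof -
  have "linear (slice_emb J)"
    by (rule linearI) (simp_all add: slice_emb_def of_real_def algebra_simps)
  then show ?thesis
    by (simp add: linear_conv_bounded_linear)
qed

lemma slice_plane_eq: "\<C> J = range (slice_emb J)"
proof
  show "\<C> J \<subseteq> range (slice_emb J)"
  proof
    fix q assume "q \<in> \<C> J"
    then obtain a b where "q - a *\<^sub>R 1 = b *\<^sub>R J"
      by (auto simp: slice_plane_def span_breakdown_eq span_singleton)
    then have "q = a *\<^sub>R 1 + b *\<^sub>R J"
      by (simp add: diff_eq_eq add.commute)
    then have "q = slice_emb J (Complex a b)"
      by (simp add: slice_emb_def of_real_def)
    then show "q \<in> range (slice_emb J)" by blast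
  qed
next
  show "range (slice_emb J) \<subseteq> \<C> J"
    unfolding slice_emb_def slice_plane_def of_real_def
    by (intro image_subsetI span_add span_scale span_base) simp_all
qed

lemma quat_in_slice:
  obtains J z where "J \<in> \<S>" "q = slice_emb J z" "0 \<le> Im z"
proof -
  define v where "v = q - of_real (qRe q)"
  \<comment> \<open>A real quaternion lies in every slice, so an arbitrary unit serves there;
    otherwise the unit is the normalised vector part, which makes the imaginary coordinate
    nonnegative.\<close>
  define J where "J = (if v = 0 then quat_i else v /\<^sub>R norm v)"
  have "J \<in> \<S>"
  proof (cases "v = 0")
    case False
    have "norm (sgn v) = 1"
      using False by (simp add: norm_sgn)
    then have "inner (sgn v) (sgn v) = 1"
      by (simp add: norm_eq_1)
    moreover have "qRe (sgn v) = 0"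
      by (simp add: sgn_quat_def v_def)
    ultimately show ?thesis
      using False by (simp add: J_def imag_sphere_iff inner_quat_def power2_eq_square sgn_quat_def)
  qed (simp add: J_def quat_i_in_imag_sphere)
  moreover have "q = slice_emb J (Complex (qRe q) (norm v))"
    by (simp add: slice_emb_def J_def) (simp add: v_def)
  ultimately show thesis
    by (intro that[of J]) auto
qed

text \<open>The Cauchy-Riemann equation says that the derivative in direction \<open>J\<close> is
  \<open>J\<close> times the derivative along the reals. The total derivative is then
  \<open>slice_emb J w * c\<close>, with \<open>c\<close> the real partial derivative. In this form
  the usual rules for \<open>has_derivative\<close> yield the closure properties.\<close>

lemma slice_regular_iff:
  "f \<in> slice_regular \<Omega> \<longleftrightarrow>
     (\<forall>J\<in>\<S>. \<forall>z. slice_emb J z \<in> \<Omega> \<longrightarrow>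
        (\<exists>c. ((\<lambda>w. f (slice_emb J w)) has_derivative (\<lambda>w. slice_emb J w * c)) (at z)))"
proof (intro iffI ballI allI impI)
  fix J z assume f: "f \<in> slice_regular \<Omega>" and J: "J \<in> \<S>" and z: "slice_emb J z \<in> \<Omega>"
  define F where "F = (\<lambda>(x, y). f (of_real x + y *\<^sub>R J))"
  define \<alpha> \<beta> where "\<alpha> = Re z" and "\<beta> = Im z"
  have "F differentiable at (\<alpha>, \<beta>)"
    and cr: "vector_derivative (\<lambda>x. f (of_real x + \<beta> *\<^sub>R J)) (at \<alpha>)
        + J * vector_derivative (\<lambda>y. f (of_real \<alpha> + y *\<^sub>R J)) (at \<beta>) = 0"
    using f J z unfolding slice_regular_def F_def \<alpha>_def \<beta>_def slice_emb_def by auto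
  then obtain F' where F': "(F has_derivative F') (at (\<alpha>, \<beta>))"
    by (auto simp: differentiable_def)
  then have lin: "linear F'"
    by (rule has_derivative_linear)
  have "((\<lambda>x. F (x, \<beta>)) has_derivative (\<lambda>t. F' (t, 0))) (at \<alpha>)"
    by (rule has_derivative_compose[of "\<lambda>x. (x, \<beta>)", OF _ F', simplified])
      (auto intro!: derivative_eq_intros)
  moreover have "(\<lambda>t. F' (t, 0)) = (\<lambda>t. t *\<^sub>R F' (1, 0))"
  proof
    show "F' (t, 0) = t *\<^sub>R F' (1, 0)" for t
      using linear_scale[OF lin, of t "(1, 0)"] by simp
  qed
  ultimately have 1: "vector_derivative (\<lambda>x. F (x, \<beta>)) (at \<alpha>) = F' (1, 0)"
    by (intro vector_derivative_at) (simp only: has_vector_derivative_def)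
  have "((\<lambda>y. F (\<alpha>, y)) has_derivative (\<lambda>t. F' (0, t))) (at \<beta>)"
    by (rule has_derivative_compose[of "\<lambda>y. (\<alpha>, y)", OF _ F', simplified])
      (auto intro!: derivative_eq_intros)
  moreover have "(\<lambda>t. F' (0, t)) = (\<lambda>t. t *\<^sub>R F' (0, 1))"
  proof
    show "F' (0, t) = t *\<^sub>R F' (0, 1)" for t
      using linear_scale[OF lin, of t "(0, 1)"] by simp
  qed
  ultimately have 2: "vector_derivative (\<lambda>y. F (\<alpha>, y)) (at \<beta>) = F' (0, 1)"
    by (intro vector_derivative_at) (simp only: has_vector_derivative_def)
  have "F' (1, 0) + J * F' (0, 1) = 0"
    using cr 1 2 by (simp add: F_def)
  \<comment> \<open>Multiplying on the left by \<open>J\<close> and using \<open>J * J = - 1\<close>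
    solves for the second partial derivative.\<close>
  then have "J * F' (1, 0) + J * (J * F' (0, 1)) = 0"
    by (metis distrib_left mult_zero_right)
  then have 3: "F' (0, 1) = J * F' (1, 0)"
    using J by (simp add: imag_sphere_square_mult)
  have "F' (s, t) = slice_emb J (Complex s t) * F' (1, 0)" for s t
  proof -
    have "F' (s, t) = F' (s *\<^sub>R (1, 0) + t *\<^sub>R (0, 1))"
      by simp
    also have "\<dots> = s *\<^sub>R F' (1, 0) + t *\<^sub>R F' (0, 1)"
      by (simp add: linear_add[OF lin] linear_scale[OF lin] del: scaleR_Pair add_Pair)
    finally show ?thesis
      by (simp add: 3 slice_emb_def distrib_right of_real_def)
  qed
  then have "F' (Re w, Im w) = slice_emb J w * F' (1, 0)" for w
    by (metis complex.collapse)
  moreover have "((\<lambda>w. F (Re w, Im w)) has_derivative (\<lambda>w. F' (Re w, Im w))) (at z)"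
    using F' by (intro has_derivative_compose[of "\<lambda>w. (Re w, Im w)", where g = F])
      (auto intro!: derivative_eq_intros simp: \<alpha>_def \<beta>_def)
  ultimately have "((\<lambda>w. F (Re w, Im w)) has_derivative (\<lambda>w. slice_emb J w * F' (1, 0))) (at z)"
    by (simp only:)
  then show "\<exists>c. ((\<lambda>w. f (slice_emb J w)) has_derivative (\<lambda>w. slice_emb J w * c)) (at z)"
    by (auto simp: F_def slice_emb_def)
next
  assume *: "\<forall>J\<in>\<S>. \<forall>z. slice_emb J z \<in> \<Omega> \<longrightarrow>
        (\<exists>c. ((\<lambda>w. f (slice_emb J w)) has_derivative (\<lambda>w. slice_emb J w * c)) (at z))"
  show "f \<in> slice_regular \<Omega>"
    unfolding slice_regular_def mem_Collect_eq
  proof (intro ballI allI impI)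
    fix J \<alpha> \<beta> assume J: "J \<in> \<S>" and z: "of_real \<alpha> + \<beta> *\<^sub>R J \<in> \<Omega>"
    then have "slice_emb J (Complex \<alpha> \<beta>) \<in> \<Omega>"
      by (simp add: slice_emb_def)
    with * J obtain c where c:
      "((\<lambda>w. f (slice_emb J w)) has_derivative (\<lambda>w. slice_emb J w * c)) (at (Complex \<alpha> \<beta>))"
      by blast
    have bl: "bounded_linear (\<lambda>p. Complex (fst p) (snd p))"
      unfolding linear_conv_bounded_linear[symmetric]
      by (rule linearI) (auto simp: complex_eq_iff)
    have "((\<lambda>p. f (slice_emb J (Complex (fst p) (snd p)))) has_derivative
            (\<lambda>p. slice_emb J (Complex (fst p) (snd p)) * c)) (at (\<alpha>, \<beta>))"
      by (rule has_derivative_compose[OF bounded_linear_imp_has_derivative[OF bl]]) (use c in simp)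
    then have d: "((\<lambda>(x, y). f (of_real x + y *\<^sub>R J)) has_derivative
            (\<lambda>p. slice_emb J (Complex (fst p) (snd p)) * c)) (at (\<alpha>, \<beta>))"
      by (simp add: slice_emb_def case_prod_beta')
    have "((\<lambda>x. f (of_real x + \<beta> *\<^sub>R J)) has_derivative (\<lambda>t. t *\<^sub>R c)) (at \<alpha>)"
      using has_derivative_compose[of "\<lambda>x. (x, \<beta>)" "\<lambda>t. (t, 0)" \<alpha> UNIV, OF _ d[simplified]]
      by (simp add: slice_emb_def of_real_def has_derivative_Pair)
    then have 1: "vector_derivative (\<lambda>x. f (of_real x + \<beta> *\<^sub>R J)) (at \<alpha>) = c"
      by (intro vector_derivative_at) (simp add: has_vector_derivative_def)
    have "((\<lambda>y. f (of_real \<alpha> + y *\<^sub>R J)) has_derivative (\<lambda>t. t *\<^sub>R (J * c))) (at \<beta>)"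
      using has_derivative_compose[of "\<lambda>y. (\<alpha>, y)" "\<lambda>t. (0, t)" \<beta> UNIV, OF _ d[simplified]]
      by (simp add: slice_emb_def has_derivative_Pair)
    then have 2: "vector_derivative (\<lambda>y. f (of_real \<alpha> + y *\<^sub>R J)) (at \<beta>) = J * c"
      by (intro vector_derivative_at) (simp add: has_vector_derivative_def)
    show "(\<lambda>(x, y). f (of_real x + y *\<^sub>R J)) differentiable at (\<alpha>, \<beta>) \<and>
     (1/2) *\<^sub>R (vector_derivative (\<lambda>x. f (of_real x + \<beta> *\<^sub>R J)) (at \<alpha>)
        + J * vector_derivative (\<lambda>y. f (of_real \<alpha> + y *\<^sub>R J)) (at \<beta>)) = 0"
      using d J by (auto simp: differentiable_def 1 2 imag_sphere_square_mult)
  qed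
qed

section \<open>Closure properties of slice regular and slice preserving functions\<close>

lemma slice_regular_const: "(\<lambda>q. c) \<in> slice_regular \<Omega>"
  unfolding slice_regular_iff by (auto intro!: exI[of _ 0])

lemma slice_regular_add:
  assumes "f \<in> slice_regular \<Omega>" "g \<in> slice_regular \<Omega>"
  shows "(\<lambda>q. f q + g q) \<in> slice_regular \<Omega>"
  unfolding slice_regular_iff
proof (intro ballI allI impI)
  fix J z assume "J \<in> \<S>" "slice_emb J z \<in> \<Omega>"
  with assms obtain c d where
    "((\<lambda>w. f (slice_emb J w)) has_derivative (\<lambda>w. slice_emb J w * c)) (at z)"
    "((\<lambda>w. g (slice_emb J w)) has_derivative (\<lambda>w. slice_emb J w * d)) (at z)"
    unfolding slice_regular_iff by meson
  from has_derivative_add[OF this]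
  show "\<exists>c. ((\<lambda>w. f (slice_emb J w) + g (slice_emb J w)) has_derivative (\<lambda>w. slice_emb J w * c)) (at z)"
    by (auto simp flip: distrib_left)
qed

lemma slice_regular_mult_const:
  assumes "f \<in> slice_regular \<Omega>"
  shows "(\<lambda>q. f q * k) \<in> slice_regular \<Omega>"
  unfolding slice_regular_iff
proof (intro ballI allI impI)
  fix J z assume "J \<in> \<S>" "slice_emb J z \<in> \<Omega>"
  with assms obtain c where
    "((\<lambda>w. f (slice_emb J w)) has_derivative (\<lambda>w. slice_emb J w * c)) (at z)"
    unfolding slice_regular_iff by meson
  from has_derivative_mult_left[OF this, of k]
  show "\<exists>c. ((\<lambda>w. f (slice_emb J w) * k) has_derivative (\<lambda>w. slice_emb J w * c)) (at z)"
    by (auto simp: mult.assoc)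
qed

lemma slice_regular_scaleR:
  "f \<in> slice_regular \<Omega> \<Longrightarrow> (\<lambda>q. r *\<^sub>R f q) \<in> slice_regular \<Omega>"
  using slice_regular_mult_const[of f \<Omega> "of_real r"] by (simp add: of_real_def)

lemma slice_regular_diff:
  "f \<in> slice_regular \<Omega> \<Longrightarrow> g \<in> slice_regular \<Omega> \<Longrightarrow> (\<lambda>q. f q - g q) \<in> slice_regular \<Omega>"
  using slice_regular_add[of f \<Omega> "\<lambda>q. (-1) *\<^sub>R g q"] slice_regular_scaleR[of g \<Omega> "-1"] by simp

lemma slice_preserving_imp_regular: "p \<in> slice_preserving \<Omega> \<Longrightarrow> p \<in> slice_regular \<Omega>"
  by (simp add: slice_preserving_def)

lemma slice_preserving_range:
  assumes "p \<in> slice_preserving \<Omega>" "J \<in> \<S>" "slice_emb J z \<in> \<Omega>"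
  obtains w where "p (slice_emb J z) = slice_emb J w"
  using assms unfolding slice_preserving_def slice_plane_eq by blast

text \<open>A pointwise product of slice regular functions is not slice regular in general, because
  the value of the left factor stands in front of the direction \<open>slice_emb J u\<close> in the
  product rule. If that value lies in the plane of \<open>J\<close>, it commutes with the direction,
  which can then be pulled out to the left.\<close>

lemma slice_regular_mult_preserving:
  assumes p: "p \<in> slice_preserving \<Omega>" and f: "f \<in> slice_regular \<Omega>"
  shows "(\<lambda>q. p q * f q) \<in> slice_regular \<Omega>"
  unfolding slice_regular_iff
proof (intro ballI allI impI)
  fix J z assume J: "J \<in> \<S>" and z: "slice_emb J z \<in> \<Omega>"
  with slice_preserving_imp_regular[OF p] f obtain c d where
    D: "((\<lambda>w. p (slice_emb J w)) has_derivative (\<lambda>w. slice_emb J w * c)) (at z)"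
    "((\<lambda>w. f (slice_emb J w)) has_derivative (\<lambda>w. slice_emb J w * d)) (at z)"
    unfolding slice_regular_iff by meson
  obtain w where w: "p (slice_emb J z) = slice_emb J w"
    using slice_preserving_range[OF p J z] .
  have "slice_emb J w * (slice_emb J u * d) + slice_emb J u * c * f (slice_emb J z) =
      slice_emb J u * (slice_emb J w * d + c * f (slice_emb J z))" for u
    using slice_emb_commute[OF J, of w u]
    by (simp add: distrib_left mult.assoc) (simp flip: mult.assoc)
  then show "\<exists>c. ((\<lambda>w. p (slice_emb J w) * f (slice_emb J w)) has_derivative (\<lambda>w. slice_emb J w * c)) (at z)"
    using has_derivative_mult[OF D] by (auto simp: w)
qed

lemma slice_preserving_iff:
  "p \<in> slice_preserving \<Omega> \<longleftrightarrow> p \<in> slice_regular \<Omega> \<and>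
     (\<forall>J\<in>\<S>. \<forall>z. slice_emb J z \<in> \<Omega> \<longrightarrow> p (slice_emb J z) \<in> \<C> J)"
  unfolding slice_preserving_def slice_plane_eq by blast

lemma slice_plane_add: "p \<in> \<C> J \<Longrightarrow> q \<in> \<C> J \<Longrightarrow> p + q \<in> \<C> J"
  by (simp add: slice_plane_def span_add)

lemma slice_plane_scaleR: "p \<in> \<C> J \<Longrightarrow> r *\<^sub>R p \<in> \<C> J"
  by (simp add: slice_plane_def span_scale)

lemma slice_plane_mult: "J \<in> \<S> \<Longrightarrow> p \<in> \<C> J \<Longrightarrow> q \<in> \<C> J \<Longrightarrow> p * q \<in> \<C> J"
  by (auto simp: slice_plane_eq simp flip: slice_emb_mult)

lemma slice_preserving_add:
  "p \<in> slice_preserving \<Omega> \<Longrightarrow> q \<in> slice_preserving \<Omega> \<Longrightarrow> (\<lambda>x. p x + q x) \<in> slice_preserving \<Omega>"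
  by (simp add: slice_preserving_iff slice_regular_add slice_plane_add)

lemma slice_preserving_scaleR:
  "p \<in> slice_preserving \<Omega> \<Longrightarrow> (\<lambda>x. r *\<^sub>R p x) \<in> slice_preserving \<Omega>"
  by (simp add: slice_preserving_iff slice_regular_scaleR slice_plane_scaleR)

lemma slice_preserving_diff:
  "p \<in> slice_preserving \<Omega> \<Longrightarrow> q \<in> slice_preserving \<Omega> \<Longrightarrow> (\<lambda>x. p x - q x) \<in> slice_preserving \<Omega>"
  using slice_preserving_add[of p \<Omega> "\<lambda>x. (-1) *\<^sub>R q x"] slice_preserving_scaleR[of q \<Omega> "-1"] by simp

lemma slice_preserving_mult:
  "p \<in> slice_preserving \<Omega> \<Longrightarrow> q \<in> slice_preserving \<Omega> \<Longrightarrow> (\<lambda>x. p x * q x) \<in> slice_preserving \<Omega>"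
  using slice_regular_mult_preserving[of p \<Omega> q]
  by (simp add: slice_preserving_iff slice_plane_mult)

lemma slice_preserving_power2:
  "p \<in> slice_preserving \<Omega> \<Longrightarrow> (\<lambda>x. (p x)\<^sup>2) \<in> slice_preserving \<Omega>"
  by (simp add: power2_eq_square slice_preserving_mult)

lemma slice_preserving_zero: "(\<lambda>x. 0) \<in> slice_preserving \<Omega>"
  by (simp add: slice_preserving_iff slice_regular_const slice_plane_def span_zero)

lemmas slice_preserving_intros = slice_preserving_add slice_preserving_scaleR
  slice_preserving_diff slice_preserving_mult slice_preserving_power2 slice_preserving_zero

lemmas slice_regular_intros = slice_regular_add slice_regular_diff slice_regular_scaleR
  slice_regular_mult_const slice_regular_mult_preserving slice_preserving_imp_regular

text \<open>A real point lies in every slice, so the value belongs to the planes of both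
  \<open>quat_i\<close> and \<open>quat_j\<close>, which meet in the reals.\<close>

lemma slice_preserving_real:
  assumes "p \<in> slice_preserving \<Omega>" "of_real x \<in> \<Omega>"
  shows "p (of_real x) = of_real (qRe (p (of_real x)))"
proof -
  obtain v w where "p (of_real x) = slice_emb quat_i v" "p (of_real x) = slice_emb quat_j w"
    using assms slice_preserving_range[of p \<Omega> _ "of_real x"]
      quat_i_in_imag_sphere quat_j_in_imag_sphere by (metis slice_emb_of_real)
  then show ?thesis
    by (simp add: slice_emb_def quat_eq_iff)
qed

section \<open>Identity principle and slice preserving components\<close>

lemma uminus_imag_sphere: "J \<in> \<S> \<Longrightarrow> - J \<in> \<S>"
  by (simp add: imag_sphere_iff)

lemma slice_emb_cnj: "slice_emb J (cnj z) = slice_emb (- J) z"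
  by (simp add: slice_emb_def)

lemma slice_emb_mem_iff:
  assumes "symmetric_slice_domain \<Omega>" "J \<in> \<S>" "K \<in> \<S>"
  shows "slice_emb J z \<in> \<Omega> \<longleftrightarrow> slice_emb K z \<in> \<Omega>"
  using assms unfolding symmetric_slice_domain_def slice_emb_def by blast

text \<open>By axial symmetry all slices of the domain have the same shape in the complex plane;
  \<open>quat_i\<close> is an arbitrary representative.\<close>

definition slice_section :: "quat set \<Rightarrow> complex set" where
  "slice_section \<Omega> = {z. slice_emb quat_i z \<in> \<Omega>}"

lemma slice_section_iff:
  "symmetric_slice_domain \<Omega> \<Longrightarrow> J \<in> \<S> \<Longrightarrow> z \<in> slice_section \<Omega> \<longleftrightarrow> slice_emb J z \<in> \<Omega>"
  using slice_emb_mem_iff[of \<Omega> quat_i J z] quat_i_in_imag_sphere by (simp add: slice_section_def)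

lemma of_real_slice_section_iff: "of_real x \<in> slice_section \<Omega> \<longleftrightarrow> of_real x \<in> \<Omega>"
  by (simp add: slice_section_def)

lemma cnj_slice_section:
  "symmetric_slice_domain \<Omega> \<Longrightarrow> z \<in> slice_section \<Omega> \<Longrightarrow> cnj z \<in> slice_section \<Omega>"
  using slice_section_iff[of \<Omega> "- quat_i" z] quat_i_in_imag_sphere
  by (simp add: slice_section_def slice_emb_cnj uminus_imag_sphere)

lemma open_slice_section:
  assumes "symmetric_slice_domain \<Omega>"
  shows "open (slice_section \<Omega>)"
proof -
  have "open (slice_emb quat_i -` \<Omega>)"
    using assms by (intro open_vimage continuous_intros
        linear_continuous_on[OF bounded_linear_slice_emb]) (simp add: symmetric_slice_domain_def)
  then show ?thesis
    by (simp add: slice_section_def vimage_def)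
qed

lemma real_point_exists:
  assumes "symmetric_slice_domain \<Omega>"
  obtains x where "of_real x \<in> \<Omega>"
  using assms by (auto simp: symmetric_slice_domain_def elim!: Reals_cases)

text \<open>The continuous map \<open>\<rho>\<close> folds the domain onto the closed upper half of
  the section. The section is the union of this connected image and its mirror image, and the two
  meet at a real point.\<close>

lemma connected_slice_section:
  assumes S: "symmetric_slice_domain \<Omega>"
  shows "connected (slice_section \<Omega>)"
proof -
  define \<rho> where "\<rho> q = Complex (qRe q) (norm (q - of_real (qRe q)))" for q
  have \<rho>_emb: "\<rho> (slice_emb J z) = z" if "J \<in> \<S>" "0 \<le> Im z" for J z
    using that by (simp add: \<rho>_def slice_emb_def imag_sphere_iff norm_imag_sphere)
  have qRe: "qRe = (\<lambda>q. inner q 1)"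
    by (simp add: inner_quat_def fun_eq_iff)
  have "continuous_on \<Omega> \<rho>"
    unfolding \<rho>_def Complex_eq qRe by (intro continuous_intros)
  then have P: "connected (\<rho> ` \<Omega>)"
    using S by (intro connected_continuous_image) (auto simp: symmetric_slice_domain_def)
  then have N: "connected (cnj ` \<rho> ` \<Omega>)"
    by (intro connected_continuous_image[where f = cnj] continuous_intros)
  have "slice_section \<Omega> = \<rho> ` \<Omega> \<union> cnj ` \<rho> ` \<Omega>" (is "_ = ?R")
  proof
    show "slice_section \<Omega> \<subseteq> ?R"
    proof
      fix z assume z: "z \<in> slice_section \<Omega>"
      show "z \<in> ?R"
      proof (cases "0 \<le> Im z")
        case True
        then show ?thesis
          using z \<rho>_emb[OF quat_i_in_imag_sphere, of z]
          by (auto simp: slice_section_def intro!: image_eqI[of _ _ "slice_emb quat_i z"])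
      next
        case False
        then show ?thesis
          using cnj_slice_section[OF S z] \<rho>_emb[OF quat_i_in_imag_sphere, of "cnj z"]
          by (auto simp: slice_section_def image_image
              intro!: image_eqI[of _ _ "slice_emb quat_i (cnj z)"])
      qed
    qed
    have "\<rho> q \<in> slice_section \<Omega>" if "q \<in> \<Omega>" for q
    proof -
      obtain J z where "J \<in> \<S>" "q = slice_emb J z" "0 \<le> Im z"
        using quat_in_slice .
      then show ?thesis
        using that \<rho>_emb slice_section_iff[OF S] by simp
    qed
    then show "?R \<subseteq> slice_section \<Omega>"
      using cnj_slice_section[OF S] by blast
  qed
  moreover obtain x where x: "of_real x \<in> \<Omega>"
    using real_point_exists[OF S] .
  then have "of_real x \<in> \<rho> ` \<Omega> \<inter> cnj ` \<rho> ` \<Omega>"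
    using \<rho>_emb[OF quat_i_in_imag_sphere, of "of_real x"]
    by (auto simp: image_image intro!: image_eqI[of _ _ "of_real x"])
  ultimately show ?thesis
    using connected_Un[OF P N] by auto
qed

text \<open>Pairing with \<^term>\<open>e\<close> on each slice: left multiplication by \<^term>\<open>J\<close> becomes
  multiplication by the complex unit, so slice regular functions become holomorphic.\<close>

definition slice_coord :: "quat \<Rightarrow> quat \<Rightarrow> quat \<Rightarrow> complex" where
  "slice_coord J e q = Complex (inner q e) (- inner (J * q) e)"

lemma slice_coord_mult:
  "J \<in> \<S> \<Longrightarrow> slice_coord J e (slice_emb J z * q) = slice_coord J e q * z"
  by (simp add: slice_coord_def slice_emb_def complex_eq_iff inner_add_left inner_diff_left of_real_def
      distrib_left distrib_right imag_sphere_square_mult)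

lemma bounded_linear_slice_coord: "bounded_linear (slice_coord J e)"
proof -
  have "linear (slice_coord J e)"
    by (rule linearI) (simp_all add: slice_coord_def complex_eq_iff inner_add_left distrib_left)
  then show ?thesis
    by (simp add: linear_conv_bounded_linear)
qed

lemma slice_coord_holomorphic:
  assumes S: "symmetric_slice_domain \<Omega>" and f: "f \<in> slice_regular \<Omega>" and J: "J \<in> \<S>"
  shows "(\<lambda>z. slice_coord J e (f (slice_emb J z))) holomorphic_on slice_section \<Omega>"
  unfolding holomorphic_on_def
proof
  fix z assume "z \<in> slice_section \<Omega>"
  with f J slice_section_iff[OF S J] obtain c where
    "((\<lambda>w. f (slice_emb J w)) has_derivative (\<lambda>w. slice_emb J w * c)) (at z)"
    unfolding slice_regular_iff by blast
  from bounded_linear.has_derivative[OF bounded_linear_slice_coord this, of J e]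
  have "((\<lambda>z. slice_coord J e (f (slice_emb J z))) has_field_derivative slice_coord J e c) (at z)"
    by (simp add: has_field_derivative_def slice_coord_mult[OF J])
  then show "(\<lambda>z. slice_coord J e (f (slice_emb J z))) field_differentiable at z within slice_section \<Omega>"
    using field_differentiable_at_within field_differentiable_def by blast
qed

text \<open>The real axis is contained in every slice, so zeros that accumulate at one real point
  accumulate in the slice through \<open>q\<close> as well. Analytic continuation of a complex
  coordinate of \<open>f\<close> along the connected section then reaches \<open>q\<close>.\<close>

lemma slice_regular_eq_0:
  assumes S: "symmetric_slice_domain \<Omega>" and f: "f \<in> slice_regular \<Omega>"
    and x0: "of_real x0 \<in> \<Omega>" and zero: "\<forall>\<^sub>F x in at x0. f (of_real x) = 0"
    and q: "q \<in> \<Omega>"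
  shows "f q = 0"
proof -
  obtain J z where J: "J \<in> \<S>" and qz: "q = slice_emb J z"
    using quat_in_slice .
  define U :: "complex set" where "U = of_real ` {x. f (of_real x) = 0} \<inter> slice_section \<Omega>"
  have nhd: "\<forall>\<^sub>F x in at x0. of_real x \<in> T" if "open T" "of_real x0 \<in> T" for T :: "complex set"
    using that by (intro topological_tendstoD[of of_real "of_real x0"] tendsto_intros) auto
  have "of_real x0 islimpt U"
  proof (rule islimptI)
    fix T :: "complex set" assume "of_real x0 \<in> T" "open T"
    then have "\<forall>\<^sub>F x in at x0. of_real x \<in> T" "\<forall>\<^sub>F x in at x0. of_real x \<in> slice_section \<Omega>"
      using nhd[of T] nhd[OF open_slice_section[OF S]] x0 by (simp_all add: of_real_slice_section_iff)
    then have "\<forall>\<^sub>F x in at x0. of_real x \<in> U \<and> of_real x \<in> T \<and> x \<noteq> x0"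
      using zero eventually_neq_at_within[of x0 x0 UNIV]
      by eventually_elim (auto simp: U_def)
    then obtain x where "of_real x \<in> U" "of_real x \<in> T" "x \<noteq> x0"
      using eventually_happens[of _ "at x0"] by auto
    then show "\<exists>y\<in>U. y \<in> T \<and> y \<noteq> of_real x0"
      by (intro bexI[of _ "of_real x"]) auto
  qed
  have "inner (f q) (f q) = 0"
  proof -
    \<comment> \<open>The coordinate is taken in the direction \<open>f q\<close> itself, so that
      its real part at \<open>z\<close> is the squared norm of \<open>f q\<close>; a single
      coordinate suffices.\<close>
    have "slice_coord J (f q) (f (slice_emb J z)) = 0"
    proof (rule analytic_continuation[where f = "\<lambda>z. slice_coord J (f q) (f (slice_emb J z))"])
      show "of_real x0 islimpt U" by fact
      show "U \<subseteq> slice_section \<Omega>" by (simp add: U_def)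
      show "slice_coord J (f q) (f (slice_emb J u)) = 0" if "u \<in> U" for u
        using that by (auto simp: U_def slice_coord_def complex_eq_iff)
    qed (use x0 q in \<open>auto simp: qz open_slice_section[OF S] connected_slice_section[OF S]
        slice_coord_holomorphic[OF S f J] of_real_slice_section_iff slice_section_iff[OF S J]\<close>)
    then show ?thesis
      by (simp add: slice_coord_def complex_eq_iff qz)
  qed
  then show ?thesis by simp
qed

lemma slice_regular_eqI:
  assumes S: "symmetric_slice_domain \<Omega>" and "f \<in> slice_regular \<Omega>" "g \<in> slice_regular \<Omega>"
    and "of_real x0 \<in> \<Omega>" "\<forall>\<^sub>F x in at x0. f (of_real x) = g (of_real x)"
    and "q \<in> \<Omega>"
  shows "f q = g q"
  using slice_regular_eq_0[OF S slice_regular_diff[of f \<Omega> g], of x0 q] assms by simp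

lemma eventually_of_real_in_domain:
  assumes S: "symmetric_slice_domain \<Omega>" and "of_real x0 \<in> \<Omega>"
  shows "\<forall>\<^sub>F x in at x0. of_real x \<in> \<Omega>"
  using assms unfolding symmetric_slice_domain_def
  by (intro topological_tendstoD[of of_real "of_real x0"]) (auto intro!: tendsto_intros)

lemma slice_regular_eqI_real:
  assumes S: "symmetric_slice_domain \<Omega>" and "f \<in> slice_regular \<Omega>" "g \<in> slice_regular \<Omega>"
    and "\<And>x. of_real x \<in> \<Omega> \<Longrightarrow> f (of_real x) = g (of_real x)"
    and "q \<in> \<Omega>"
  shows "f q = g q"
proof -
  obtain x0 where "of_real x0 \<in> \<Omega>"
    using real_point_exists[OF S] .
  then show ?thesis
    using eventually_mono[OF eventually_of_real_in_domain[OF S]] assms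
    by (intro slice_regular_eqI[of \<Omega> f g x0]) auto
qed

lemma slice_regular_isCont_real:
  assumes f: "f \<in> slice_regular \<Omega>" and x: "of_real x \<in> \<Omega>"
  shows "isCont (\<lambda>x. f (of_real x)) x"
proof -
  have "slice_emb quat_i (of_real x) \<in> \<Omega>"
    using x by simp
  then have "isCont (\<lambda>w. f (slice_emb quat_i w)) (of_real x)"
    using f quat_i_in_imag_sphere has_derivative_continuous unfolding slice_regular_iff by blast
  then have "isCont (\<lambda>x. f (slice_emb quat_i (of_real x))) x"
    by (rule isCont_o2[rotated]) simp
  then show ?thesis by simp
qed

lemma slice_regular_eventually_nonzero:
  assumes "f \<in> slice_regular \<Omega>" "of_real x \<in> \<Omega>" "f (of_real x) \<noteq> 0"
  shows "\<forall>\<^sub>F x in at x. f (of_real x) \<noteq> 0"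
  using tendsto_imp_eventually_ne slice_regular_isCont_real[OF assms(1,2)] assms(3)
  unfolding isCont_def by blast

text \<open>By continuity \<open>f\<close> stays nonzero at real points near \<open>x0\<close>.
  Quaternions have no zero divisors, so \<open>g\<close> vanishes there, and the identity principle
  applies.\<close>

lemma slice_regular_mult_eq_0:
  assumes S: "symmetric_slice_domain \<Omega>" and f: "f \<in> slice_regular \<Omega>" and g: "g \<in> slice_regular \<Omega>"
    and fg: "\<And>x. of_real x \<in> \<Omega> \<Longrightarrow> f (of_real x) * g (of_real x) = 0"
    and x0: "of_real x0 \<in> \<Omega>" "f (of_real x0) \<noteq> 0"
    and q: "q \<in> \<Omega>"
  shows "g q = 0"
proof (rule slice_regular_eq_0[OF S g x0(1) _ q])
  show "\<forall>\<^sub>F x in at x0. g (of_real x) = 0"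
    using slice_regular_eventually_nonzero[OF f x0] eventually_of_real_in_domain[OF S x0(1)]
    by eventually_elim (use fg in auto)
qed

text \<open>Derivatives at points of the domain only see nearby points of the section, which is
  open; this makes values outside the domain irrelevant.\<close>

lemma slice_regular_cong:
  assumes S: "symmetric_slice_domain \<Omega>" and f: "f \<in> slice_regular \<Omega>"
    and fg: "\<And>q. q \<in> \<Omega> \<Longrightarrow> f q = g q"
  shows "g \<in> slice_regular \<Omega>"
  unfolding slice_regular_iff
proof (intro ballI allI impI)
  fix J z assume J: "J \<in> \<S>" and z: "slice_emb J z \<in> \<Omega>"
  with f obtain c where
    "((\<lambda>w. f (slice_emb J w)) has_derivative (\<lambda>w. slice_emb J w * c)) (at z)"
    unfolding slice_regular_iff by meson
  then have "((\<lambda>w. g (slice_emb J w)) has_derivative (\<lambda>w. slice_emb J w * c)) (at z)"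
    by (rule has_derivative_transform_within_open[OF _ open_slice_section[OF S]])
      (use z fg J slice_section_iff[OF S] in auto)
  then show "\<exists>c. ((\<lambda>w. g (slice_emb J w)) has_derivative (\<lambda>w. slice_emb J w * c)) (at z)" ..
qed

lemma slice_preserving_cong:
  assumes S: "symmetric_slice_domain \<Omega>" and f: "f \<in> slice_preserving \<Omega>"
    and "\<And>q. q \<in> \<Omega> \<Longrightarrow> f q = g q"
  shows "g \<in> slice_preserving \<Omega>"
  using assms slice_regular_cong[OF S, of f g] by (simp add: slice_preserving_iff)

lemma one_slice_preserving_iff:
  "f \<in> one_slice_preserving \<Omega> J \<longleftrightarrow>
     f \<in> slice_regular \<Omega> \<and> (\<forall>z. slice_emb J z \<in> \<Omega> \<longrightarrow> f (slice_emb J z) \<in> \<C> J)"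
  unfolding one_slice_preserving_def slice_plane_eq by blast

text \<open>The pairs \<open>(J, z)\<close> and \<open>(- J, cnj z)\<close> name the same
  quaternion, so transporting one function \<open>F\<close> to all slices is consistent exactly when
  \<open>F\<close> commutes with conjugation.\<close>

lemma holomorphic_induces_slice_preserving:
  assumes S: "symmetric_slice_domain \<Omega>" and F: "F holomorphic_on slice_section \<Omega>"
    and sym: "\<And>z. F (cnj z) = cnj (F z)"
  obtains p where "p \<in> slice_preserving \<Omega>" "\<And>J z. J \<in> \<S> \<Longrightarrow> p (slice_emb J z) = slice_emb J (F z)"
proof -
  \<comment> \<open>The slice of \<open>q\<close> is recovered from its vector part
    \<open>v\<close>: the unit is \<open>sgn v\<close> and the imaginary coordinate is
    \<open>norm v\<close>. At real \<open>q\<close> the value \<open>sgn v = 0\<close> does no harm,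
    as \<open>F\<close> is real on the real axis by its symmetry.\<close>
  define p where "p q = (let v = q - of_real (qRe q); w = F (Complex (qRe q) (norm v))
                         in of_real (Re w) + Im w *\<^sub>R sgn v)" for q
  have p: "p (slice_emb J z) = slice_emb J (F z)" if J: "J \<in> \<S>" for J z
  proof -
    have v: "slice_emb J z - of_real (Re z) = Im z *\<^sub>R J"
      by (simp add: slice_emb_def)
    have re: "qRe (slice_emb J z) = Re z"
      using J by (simp add: slice_emb_def imag_sphere_iff)
    have sgn_J: "sgn J = J"
      using norm_imag_sphere[OF J] by (simp add: sgn_quat_def)
    have "norm (Im z *\<^sub>R J) = \<bar>Im z\<bar>"
      using norm_imag_sphere[OF J] by simp
    then have p_emb: "p (slice_emb J z) = of_real (Re (F (Complex (Re z) \<bar>Im z\<bar>)))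
        + (Im (F (Complex (Re z) \<bar>Im z\<bar>)) * sgn (Im z)) *\<^sub>R J"
      by (simp only: p_def Let_def re v sgn_scaleR sgn_J) simp
    \<comment> \<open>The formula for \<open>p\<close> always evaluates \<open>F\<close> in the
      closed upper half plane, so points below the axis need the symmetry of
      \<open>F\<close>.\<close>
    consider "Im z > 0" | "Im z = 0" | "Im z < 0" by linarith
    then show ?thesis
    proof cases
      case 1
      then show ?thesis
        by (simp add: p_emb slice_emb_def[of J "F z"])
    next
      case 2
      then have "cnj z = z"
        by (simp add: complex_eq_iff)
      then have "cnj (F z) = F z"
        using sym[of z] by simp
      then have "Im (F z) = 0"
        by (simp add: complex_eq_iff)
      moreover have "Complex (Re z) 0 = z"
        using 2 by (simp add: complex_eq_iff)
      ultimately show ?thesis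
        using 2 by (simp add: p_emb slice_emb_def[of J "F z"])
    next
      case 3
      then have "Complex (Re z) (- Im z) = cnj z"
        by (simp add: complex_eq_iff)
      then show ?thesis
        using 3 by (simp add: p_emb slice_emb_def[of J "F z"] sym)
    qed
  qed
  have "p \<in> slice_preserving \<Omega>"
    unfolding slice_preserving_iff slice_regular_iff
  proof (intro conjI ballI allI impI)
    fix J z assume J: "J \<in> \<S>" and z: "slice_emb J z \<in> \<Omega>"
    then obtain F' where "(F has_field_derivative F') (at z)"
      using F open_slice_section[OF S] slice_section_iff[OF S J]
      by (metis holomorphic_on_imp_differentiable_at field_differentiable_def)
    then have "(F has_derivative (\<lambda>w. w * F')) (at z)"
      by (simp add: has_field_derivative_def mult_commute_abs)
    from bounded_linear.has_derivative[OF bounded_linear_slice_emb this, of J]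
    show "\<exists>c. ((\<lambda>w. p (slice_emb J w)) has_derivative (\<lambda>w. slice_emb J w * c)) (at z)"
      using J by (auto simp: p slice_emb_mult)
    show "p (slice_emb J z) \<in> \<C> J"
      using J by (simp add: p slice_plane_eq)
  qed
  with p show thesis
    by (rule that[rotated])
qed

text \<open>Components exist in every direction \<open>e\<close>, not only along a fixed basis,
  which later allows projection onto an arbitrary slice plane.\<close>

lemma slice_preserving_component:
  assumes S: "symmetric_slice_domain \<Omega>" and f: "f \<in> slice_regular \<Omega>"
  obtains p where "p \<in> slice_preserving \<Omega>" "\<And>x. p (of_real x) = of_real (inner (f (of_real x)) e)"
proof -
  define H where "H z = slice_coord quat_i e (f (slice_emb quat_i z))" for z
  \<comment> \<open>On the real axis the real part of \<open>H\<close> is the wanted component and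
    its imaginary part is extraneous. Averaging with the mirror image keeps the former, removes the
    latter, and makes \<open>F\<close> commute with conjugation.\<close>
  define F where "F z = (H z + cnj (H (cnj z))) / 2" for z
  have H: "H holomorphic_on slice_section \<Omega>"
    unfolding H_def by (rule slice_coord_holomorphic[OF S f quat_i_in_imag_sphere])
  have "cnj ` slice_section \<Omega> = slice_section \<Omega>"
    using cnj_slice_section[OF S] by (force intro: image_eqI[of _ cnj "cnj _"])
  then have "F holomorphic_on slice_section \<Omega>"
    using holomorphic_on_compose_cnj_cnj[of H "slice_section \<Omega>"] H open_slice_section[OF S]
    unfolding F_def by (intro holomorphic_intros) (auto simp: o_def)
  then obtain p where p: "p \<in> slice_preserving \<Omega>" "\<And>J z. J \<in> \<S> \<Longrightarrow> p (slice_emb J z) = slice_emb J (F z)"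
    by (rule holomorphic_induces_slice_preserving[OF S]) (auto simp: F_def add.commute)
  have "p (of_real x) = of_real (inner (f (of_real x)) e)" for x
    using p(2)[OF quat_i_in_imag_sphere, of "of_real x"]
    by (simp add: F_def H_def slice_coord_def slice_emb_def)
  with p(1) show thesis
    by (rule that)
qed

section \<open>Regular product and adapted bases\<close>

lemma quat_times_sel:
  "qRe (x * y) = qRe x * qRe y - qI x * qI y - qJ x * qJ y - qK x * qK y"
  "qI (x * y) = qRe x * qI y + qI x * qRe y + qJ x * qK y - qK x * qJ y"
  "qJ (x * y) = qRe x * qJ y - qI x * qK y + qJ x * qRe y + qK x * qI y"
  "qK (x * y) = qRe x * qK y + qI x * qJ y - qJ x * qI y + qK x * qRe y"
  by (simp_all add: times_quat_def)

lemma quat_numeral_sel [simp]: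
  "qRe (numeral n) = numeral n" "qI (numeral n) = 0" "qJ (numeral n) = 0" "qK (numeral n) = 0"
  using of_real_quat_sel[of "numeral n"] by simp_all

lemma slice_preserving_eqI:
  assumes "symmetric_slice_domain \<Omega>" "p \<in> slice_preserving \<Omega>" "r \<in> slice_preserving \<Omega>"
    and "\<And>x. of_real x \<in> \<Omega> \<Longrightarrow> p (of_real x) = r (of_real x)"
  shows "\<forall>q\<in>\<Omega>. p q = r q"
  using assms slice_regular_eqI_real slice_preserving_imp_regular by blast

definition quat_cnj :: "quat \<Rightarrow> quat" where
  "quat_cnj q = Quat (qRe q) (- qI q) (- qJ q) (- qK q)"

text \<open>At real points this is the expansion in the orthonormal basis of the quaternions. It
  guarantees that the choice in \<open>slice_components\<close> picks an actual
  decomposition.\<close>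

lemma slice_decomp_exists:
  assumes S: "symmetric_slice_domain \<Omega>" and f: "f \<in> slice_regular \<Omega>"
  shows "\<exists>f0 f1 f2 f3. slice_decomp \<Omega> quat_i quat_j quat_k f f0 f1 f2 f3"
proof -
  obtain f0 where f0: "f0 \<in> slice_preserving \<Omega>"
    "\<And>x. f0 (of_real x) = of_real (inner (f (of_real x)) 1)"
    using slice_preserving_component[OF S f] by blast
  obtain f1 where f1: "f1 \<in> slice_preserving \<Omega>"
    "\<And>x. f1 (of_real x) = of_real (inner (f (of_real x)) quat_i)"
    using slice_preserving_component[OF S f] by blast
  obtain f2 where f2: "f2 \<in> slice_preserving \<Omega>"
    "\<And>x. f2 (of_real x) = of_real (inner (f (of_real x)) quat_j)"
    using slice_preserving_component[OF S f] by blast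
  obtain f3 where f3: "f3 \<in> slice_preserving \<Omega>"
    "\<And>x. f3 (of_real x) = of_real (inner (f (of_real x)) quat_k)"
    using slice_preserving_component[OF S f] by blast
  have "f q = f0 q + f1 q * quat_i + f2 q * quat_j + f3 q * quat_k" if "q \<in> \<Omega>" for q
  proof (rule slice_regular_eqI_real[OF S f _ _ that])
    show "(\<lambda>q. f0 q + f1 q * quat_i + f2 q * quat_j + f3 q * quat_k) \<in> slice_regular \<Omega>"
      by (intro slice_regular_intros f0 f1 f2 f3)
  qed (simp add: f0 f1 f2 f3 quat_eq_iff quat_times_sel inner_quat_def)
  then show ?thesis
    using f0 f1 f2 f3 unfolding slice_decomp_def by blast
qed

lemma slice_componentsE:
  assumes "symmetric_slice_domain \<Omega>" "f \<in> slice_regular \<Omega>"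
  obtains f0 f1 f2 f3 where "slice_components \<Omega> f = (f0, f1, f2, f3)"
    "slice_decomp \<Omega> quat_i quat_j quat_k f f0 f1 f2 f3"
proof -
  have "\<exists>c. case c of (f0, f1, f2, f3) \<Rightarrow> slice_decomp \<Omega> quat_i quat_j quat_k f f0 f1 f2 f3"
    using slice_decomp_exists[OF assms] by simp
  from someI_ex[OF this] show thesis
    unfolding slice_components_def[symmetric] by (auto intro: that)
qed

text \<open>At a real point any decomposition has real coefficients, so the result does not depend
  on the one selected by \<open>slice_components\<close>. The same holds for the product below, and
  afterwards the chosen components are no longer needed.\<close>

lemma
  assumes S: "symmetric_slice_domain \<Omega>" and f: "f \<in> slice_regular \<Omega>"
  shows regular_conj_regular: "regular_conj \<Omega> f \<in> slice_regular \<Omega>"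
    and regular_conj_real:
      "of_real x \<in> \<Omega> \<Longrightarrow> regular_conj \<Omega> f (of_real x) = quat_cnj (f (of_real x))"
proof -
  obtain f0 f1 f2 f3 where c: "slice_components \<Omega> f = (f0, f1, f2, f3)"
    and "slice_decomp \<Omega> quat_i quat_j quat_k f f0 f1 f2 f3"
    using slice_componentsE[OF S f] .
  then have p: "f0 \<in> slice_preserving \<Omega>" "f1 \<in> slice_preserving \<Omega>"
      "f2 \<in> slice_preserving \<Omega>" "f3 \<in> slice_preserving \<Omega>"
    and eq: "\<And>q. q \<in> \<Omega> \<Longrightarrow> f q = f0 q + f1 q * quat_i + f2 q * quat_j + f3 q * quat_k"
    by (auto simp: slice_decomp_def)
  have conj: "regular_conj \<Omega> f = (\<lambda>q. f0 q - f1 q * quat_i - f2 q * quat_j - f3 q * quat_k)"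
    by (simp add: regular_conj_def c)
  show "regular_conj \<Omega> f \<in> slice_regular \<Omega>"
    unfolding conj by (intro slice_regular_intros p)
  assume x: "of_real x \<in> \<Omega>"
  obtain r0 r1 r2 r3 where "f0 (of_real x) = of_real r0" "f1 (of_real x) = of_real r1"
    "f2 (of_real x) = of_real r2" "f3 (of_real x) = of_real r3"
    using p[THEN slice_preserving_real, OF x] by metis
  then show "regular_conj \<Omega> f (of_real x) = quat_cnj (f (of_real x))"
    by (simp add: conj eq[OF x] quat_cnj_def quat_eq_iff quat_times_sel)
qed

lemma
  assumes S: "symmetric_slice_domain \<Omega>" and f: "f \<in> slice_regular \<Omega>" and g: "g \<in> slice_regular \<Omega>"
  shows star_prod_regular: "star_prod \<Omega> f g \<in> slice_regular \<Omega>"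
    and star_prod_real:
      "of_real x \<in> \<Omega> \<Longrightarrow> star_prod \<Omega> f g (of_real x) = f (of_real x) * g (of_real x)"
proof -
  obtain f0 f1 f2 f3 where cf: "slice_components \<Omega> f = (f0, f1, f2, f3)"
    and "slice_decomp \<Omega> quat_i quat_j quat_k f f0 f1 f2 f3"
    using slice_componentsE[OF S f] .
  then have p: "f0 \<in> slice_preserving \<Omega>" "f1 \<in> slice_preserving \<Omega>"
      "f2 \<in> slice_preserving \<Omega>" "f3 \<in> slice_preserving \<Omega>"
    and eqf: "\<And>q. q \<in> \<Omega> \<Longrightarrow> f q = f0 q + f1 q * quat_i + f2 q * quat_j + f3 q * quat_k"
    by (auto simp: slice_decomp_def)
  obtain g0 g1 g2 g3 where cg: "slice_components \<Omega> g = (g0, g1, g2, g3)"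
    and "slice_decomp \<Omega> quat_i quat_j quat_k g g0 g1 g2 g3"
    using slice_componentsE[OF S g] .
  then have r: "g0 \<in> slice_preserving \<Omega>" "g1 \<in> slice_preserving \<Omega>"
      "g2 \<in> slice_preserving \<Omega>" "g3 \<in> slice_preserving \<Omega>"
    and eqg: "\<And>q. q \<in> \<Omega> \<Longrightarrow> g q = g0 q + g1 q * quat_i + g2 q * quat_j + g3 q * quat_k"
    by (auto simp: slice_decomp_def)
  note prod = star_prod_def[of \<Omega> f g, unfolded cf cg prod.case]
  show "star_prod \<Omega> f g \<in> slice_regular \<Omega>"
    unfolding prod by (intro slice_regular_intros p r)
  assume x: "of_real x \<in> \<Omega>"
  obtain r0 r1 r2 r3 where "f0 (of_real x) = of_real r0" "f1 (of_real x) = of_real r1"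
    "f2 (of_real x) = of_real r2" "f3 (of_real x) = of_real r3"
    using p[THEN slice_preserving_real, OF x] by metis
  moreover obtain s0 s1 s2 s3 where "g0 (of_real x) = of_real s0" "g1 (of_real x) = of_real s1"
    "g2 (of_real x) = of_real s2" "g3 (of_real x) = of_real s3"
    using r[THEN slice_preserving_real, OF x] by metis
  ultimately show "star_prod \<Omega> f g (of_real x) = f (of_real x) * g (of_real x)"
    by (simp add: prod eqf[OF x] eqg[OF x] quat_eq_iff quat_times_sel)
qed

lemma one_slice_preservingI:
  assumes J: "J \<in> \<S>" and p: "p0 \<in> slice_preserving \<Omega>" "p1 \<in> slice_preserving \<Omega>"
  shows "(\<lambda>q. p0 q + p1 q * J) \<in> one_slice_preserving \<Omega> J"
proof -
  have "J \<in> \<C> J"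
    by (simp add: slice_plane_def span_base)
  then show ?thesis
    using J p slice_regular_add[of p0 \<Omega> "\<lambda>q. p1 q * J"] slice_regular_mult_const[of p1 \<Omega> J]
    by (auto simp: one_slice_preserving_iff slice_preserving_iff
        intro!: slice_plane_add slice_plane_mult)
qed

lemma slice_plane_coordinates:
  assumes J: "J \<in> \<S>" and q: "q \<in> \<C> J"
  shows "q = of_real (inner q 1) + of_real (inner q J) * J"
proof -
  obtain w where w: "q = slice_emb J w"
    using q by (auto simp: slice_plane_eq)
  have "inner J J = 1" "inner J 1 = 0" "inner 1 J = 0" "inner (1 :: quat) 1 = 1"
    using J norm_imag_sphere[OF J] by (simp_all add: norm_eq_1 inner_quat_def imag_sphere_iff)
  then have "inner (slice_emb J w) 1 = Re w" "inner (slice_emb J w) J = Im w"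
    by (simp_all add: slice_emb_def inner_add_left of_real_def)
  then show ?thesis
    by (simp add: w) (simp add: slice_emb_def of_real_def[of "Im w"])
qed

lemma one_slice_preserving_real:
  "f \<in> one_slice_preserving \<Omega> J \<Longrightarrow> of_real x \<in> \<Omega> \<Longrightarrow> f (of_real x) \<in> \<C> J"
  using slice_emb_of_real[of J x] unfolding one_slice_preserving_iff by metis

text \<open>The functions \<open>p0\<close> and \<open>p1\<close> give the orthogonal projection of
  \<open>f\<close> onto the plane of \<open>J\<close> along the real axis. The membership condition
  is imposed point by point because the lemma is also applied to a quotient not known to preserve
  the slice.\<close>

lemma slice_regular_plane_components:
  assumes S: "symmetric_slice_domain \<Omega>" and J: "J \<in> \<S>" and reg: "f \<in> slice_regular \<Omega>"
  obtains p0 p1 where "p0 \<in> slice_preserving \<Omega>" "p1 \<in> slice_preserving \<Omega>"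
    "\<And>x. f (of_real x) \<in> \<C> J \<Longrightarrow> f (of_real x) = p0 (of_real x) + p1 (of_real x) * J"
proof -
  obtain p0 where p0: "p0 \<in> slice_preserving \<Omega>"
    "\<And>x. p0 (of_real x) = of_real (inner (f (of_real x)) 1)"
    using slice_preserving_component[OF S reg] by blast
  obtain p1 where p1: "p1 \<in> slice_preserving \<Omega>"
    "\<And>x. p1 (of_real x) = of_real (inner (f (of_real x)) J)"
    using slice_preserving_component[OF S reg] by blast
  have "f (of_real x) = p0 (of_real x) + p1 (of_real x) * J" if "f (of_real x) \<in> \<C> J" for x
    using slice_plane_coordinates[OF J that] by (simp add: p0 p1)
  with p0(1) p1(1) show thesis
    by (rule that)
qed

section \<open>Orthonormal bases adapted to two imaginary units\<close>

lemma
  assumes I: "I0 \<in> \<S>" and M: "M0 \<in> \<S>"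
    and K: "K0 = (I0 \<and>\<^sub>H M0) /\<^sub>R norm (I0 \<and>\<^sub>H M0)" and J: "J0 = K0 * I0"
    and M0: "M0 = a *\<^sub>R I0 + b *\<^sub>R J0" and b: "b > 0" and ab: "a\<^sup>2 + b\<^sup>2 = 1"
  shows adapted_K0: "K0 \<in> \<S>"
    and adapted_inner: "inner K0 I0 = 0"
proof -
  define W where "W = I0 \<and>\<^sub>H M0"
  have W: "qRe W = 0" "inner W I0 = 0"
    by (simp_all add: W_def quat_wedge_def quat_of_Im_def quat_Im_def cross3_def inner_quat_def algebra_simps)
  \<comment> \<open>If \<open>W\<close> were 0, then \<open>K0\<close> and \<open>J0\<close> would
    be 0 too, and \<open>M0 = a *\<^sub>R I0\<close> with both units of norm 1 would give
    \<open>a\<^sup>2 = 1\<close>, contradicting \<open>b > 0\<close>.\<close>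
  have "W \<noteq> 0"
  proof
    assume "W = 0"
    then have "K0 = 0"
      unfolding K W_def by simp
    then have "M0 = a *\<^sub>R I0"
      unfolding M0 J by simp
    then have "\<bar>a\<bar> = 1"
      using norm_imag_sphere[OF I] norm_imag_sphere[OF M] by simp
    then have "a\<^sup>2 = 1"
      by (simp add: abs_square_eq_1)
    with ab b show False by simp
  qed
  have K0: "K0 = W /\<^sub>R norm W"
    unfolding K W_def ..
  with \<open>W \<noteq> 0\<close> have "norm K0 = 1"
    by simp
  then have "inner K0 K0 = 1"
    by (simp add: norm_eq_1)
  moreover have "qRe K0 = 0"
    unfolding K0 by (simp add: W)
  ultimately show "K0 \<in> \<S>"
    by (simp add: imag_sphere_iff inner_quat_def power2_eq_square)
  show "inner K0 I0 = 0"
    unfolding K0 by (simp add: W)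
qed

text \<open>Orthogonal imaginary units anticommute. Together with associativity and the squares this
  gives \<open>I0\<close>, \<open>J0\<close>, \<open>K0\<close> the multiplication table of
  \<open>i\<close>, \<open>j\<close>, \<open>k\<close>.\<close>

lemma
  assumes I: "I0 \<in> \<S>" and K: "K0 \<in> \<S>" and orth: "inner K0 I0 = 0" and J: "J0 = K0 * I0"
  shows orthogonal_units_mult: "I0 * K0 = - J0" "K0 * J0 = - I0" "J0 * I0 = - K0" "I0 * J0 = K0"
      "J0 * K0 = I0" "J0 * J0 = -1"
    and orthogonal_units_inner: "inner I0 J0 = 0" "inner K0 J0 = 0"
    and orthogonal_units_J: "J0 \<in> \<S>"
proof -
  have 1: "I0 * K0 = - (K0 * I0)"
    using I K orth by (simp add: imag_sphere_iff quat_eq_iff quat_times_sel inner_quat_def algebra_simps)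
  then show 2: "I0 * K0 = - J0"
    by (simp add: J)
  show "K0 * J0 = - I0"
    by (simp add: J K imag_sphere_square_mult)
  show 3: "J0 * I0 = - K0"
    by (simp add: J mult.assoc I imag_sphere_square)
  show 4: "I0 * J0 = K0"
    using 2 3 by (metis "1" J mult.assoc mult_minus_left minus_minus)
  show 5: "J0 * K0 = I0"
    using 1 K by (metis J imag_sphere_square_mult minus_minus mult.assoc mult_minus_right)
  show "J0 * J0 = -1"
    using 4 K by (metis J imag_sphere_square mult.assoc)
  then show "J0 \<in> \<S>"
    by (simp add: imag_sphere_def power2_eq_square)
  show "inner I0 J0 = 0" "inner K0 J0 = 0"
    using I K by (simp_all add: J imag_sphere_iff inner_quat_def quat_times_sel algebra_simps)
qed

lemma orthogonal_units_coeffs: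
  assumes I: "I0 \<in> \<S>" and K: "K0 \<in> \<S>" and orth: "inner K0 I0 = 0" and J: "J0 = K0 * I0"
    and eq: "of_real r0 + r1 *\<^sub>R I0 + r2 *\<^sub>R J0 + r3 *\<^sub>R K0 =
      of_real s0 + s1 *\<^sub>R I0 + s2 *\<^sub>R J0 + s3 *\<^sub>R K0"
  shows "r0 = s0 \<and> r1 = s1 \<and> r2 = s2 \<and> r3 = s3"
proof -
  note J' = orthogonal_units_J[OF I K orth J] and inn = orthogonal_units_inner[OF I K orth J]
  have im: "inner 1 u = 0" "inner u 1 = 0" "inner u u = 1" "inner (1 :: quat) 1 = 1" if "u \<in> \<S>" for u
    using that norm_imag_sphere[OF that] by (simp_all add: norm_eq_1 inner_quat_def imag_sphere_iff)
  have "inner (of_real r0 + r1 *\<^sub>R I0 + r2 *\<^sub>R J0 + r3 *\<^sub>R K0) u =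
      inner (of_real s0 + s1 *\<^sub>R I0 + s2 *\<^sub>R J0 + s3 *\<^sub>R K0) u" for u
    using eq by simp
  from this[of 1] this[of I0] this[of J0] this[of K0] show ?thesis
    using orth inn by (simp add: inner_add_left inner_add_right of_real_def im I K J' inner_commute)
qed

text \<open>For \<^term>\<open>M \<in> \<S>\<close>, the map \<open>v \<mapsto> - M v M\<close> is the half-turn about \<^term>\<open>M\<close>,
  whence the double-angle coefficients \<open>2 a\<^sup>2 - 1\<close> and \<open>2 a b\<close>.\<close>

lemma conjugation_in_adapted_basis:
  assumes I: "I0 \<in> \<S>" and K: "K0 \<in> \<S>" and orth: "inner K0 I0 = 0" and J: "J0 = K0 * I0"
    and M: "M0 = a *\<^sub>R I0 + b *\<^sub>R J0" and ab: "a\<^sup>2 + b\<^sup>2 = 1"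
  shows "(of_real h0 + h1 *\<^sub>R M0) * (of_real f0 + f1 *\<^sub>R I0) * (of_real h0 - h1 *\<^sub>R M0) =
    of_real ((h0\<^sup>2 + h1\<^sup>2) * f0) + ((h0\<^sup>2 + (2 * a\<^sup>2 - 1) * h1\<^sup>2) * f1) *\<^sub>R I0
      + (2 * a * b * h1\<^sup>2 * f1) *\<^sub>R J0 + (- 2 * b * h0 * h1 * f1) *\<^sub>R K0"
proof -
  note m = orthogonal_units_mult[OF I K orth J] J[symmetric] imag_sphere_square[OF I] imag_sphere_square[OF K]
  have b2: "b * b = 1 - a * a"
    using ab by (simp add: power2_eq_square)
  have MI: "M0 * I0 = (- a) *\<^sub>R 1 - b *\<^sub>R K0"
    by (simp add: M distrib_right m)
  have IM: "I0 * M0 = (- a) *\<^sub>R 1 + b *\<^sub>R K0"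
    by (simp add: M distrib_left m)
  have MM: "M0 * M0 = (- 1) *\<^sub>R 1"
    by (simp add: M distrib_left distrib_right m b2 algebra_simps)
  have MIM: "M0 * I0 * M0 = (1 - 2 * a * a) *\<^sub>R I0 - (2 * a * b) *\<^sub>R J0"
    unfolding MI by (simp add: M m b2 algebra_simps) (simp add: quat_eq_iff)
  \<comment> \<open>Real coefficients are central, so the mixed terms with \<open>f0\<close> cancel.
    Those with \<open>f1\<close> form the commutator of \<open>M0\<close> and \<open>I0\<close>,
    which is \<open>- 2 * b\<close> times \<open>K0\<close>.\<close>
  have "(of_real h0 + h1 *\<^sub>R M0) * (of_real f0 + f1 *\<^sub>R I0) * (of_real h0 - h1 *\<^sub>R M0) =
      (f0 * h0 * h0) *\<^sub>R 1 - (f0 * h1 * h1) *\<^sub>R (M0 * M0) + (f1 * h0 * h0) *\<^sub>R I0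
        + (f1 * h0 * h1) *\<^sub>R (M0 * I0 - I0 * M0) - (f1 * h1 * h1) *\<^sub>R (M0 * I0 * M0)"
    by (simp add: of_real_def algebra_simps)
  also have "\<dots> = of_real ((h0\<^sup>2 + h1\<^sup>2) * f0) + ((h0\<^sup>2 + (2 * a\<^sup>2 - 1) * h1\<^sup>2) * f1) *\<^sub>R I0
      + (2 * a * b * h1\<^sup>2 * f1) *\<^sub>R J0 + (- 2 * b * h0 * h1 * f1) *\<^sub>R K0"
    by (subst MIM, subst MI, subst IM, subst MM)
      (simp add: of_real_def quat_eq_iff power2_eq_square algebra_simps)
  finally show ?thesis .
qed

section \<open>The product of \<open>h\<close>, \<open>f\<close> and the conjugate of
  \<open>h\<close> in scalar components\<close>

lemma quat_mult_cnj: "q * quat_cnj q = of_real ((norm q)\<^sup>2)"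
  by (simp add: quat_eq_iff quat_times_sel quat_cnj_def power2_norm_eq_inner inner_quat_def)

lemma quat_cnj_slice:
  "J \<in> \<S> \<Longrightarrow> quat_cnj (of_real r + of_real s * J) = of_real r - s *\<^sub>R J"
  by (simp add: quat_cnj_def quat_eq_iff quat_times_sel imag_sphere_iff)

lemma
  assumes S: "symmetric_slice_domain \<Omega>" and h: "h \<in> slice_regular \<Omega>" and f: "f \<in> slice_regular \<Omega>"
  shows star_conjugation_regular:
      "star_prod \<Omega> (star_prod \<Omega> h f) (regular_conj \<Omega> h) \<in> slice_regular \<Omega>"
    and star_conjugation_real: "of_real x \<in> \<Omega> \<Longrightarrow>
      star_prod \<Omega> (star_prod \<Omega> h f) (regular_conj \<Omega> h) (of_real x)
        = h (of_real x) * f (of_real x) * quat_cnj (h (of_real x))"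
  using star_prod_regular[OF S h f] star_prod_real[OF S h f] regular_conj_regular[OF S h]
    regular_conj_real[OF S h]
  by (simp_all add: star_prod_regular[OF S] star_prod_real[OF S])

text \<open>The conjugate is defined through the standard basis while \<open>h\<close> is given
  along \<open>M\<close>. At real points both describe the same quaternion, whose squared norm is
  the right-hand side.\<close>

lemma symmetrized_eq:
  assumes S: "symmetric_slice_domain \<Omega>" and h: "h \<in> slice_regular \<Omega>" and M: "M \<in> \<S>"
    and h01: "h0 \<in> slice_preserving \<Omega>" "h1 \<in> slice_preserving \<Omega>"
    and heq: "\<forall>q\<in>\<Omega>. h q = h0 q + h1 q * M"
    and q: "q \<in> \<Omega>"
  shows "symmetrized \<Omega> h q = (h0 q)\<^sup>2 + (h1 q)\<^sup>2"
proof (rule slice_regular_eqI_real[OF S _ _ _ q])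
  show "symmetrized \<Omega> h \<in> slice_regular \<Omega>"
    unfolding symmetrized_def by (intro star_prod_regular regular_conj_regular S h)
  show "(\<lambda>q. (h0 q)\<^sup>2 + (h1 q)\<^sup>2) \<in> slice_regular \<Omega>"
    by (intro slice_preserving_imp_regular slice_preserving_intros h01)
  fix x :: real assume x: "of_real x \<in> \<Omega>"
  obtain r s where rs: "h0 (of_real x) = of_real r" "h1 (of_real x) = of_real s"
    using h01[THEN slice_preserving_real, OF x] by metis
  have "symmetrized \<Omega> h (of_real x) = h (of_real x) * quat_cnj (h (of_real x))"
    using x by (simp add: symmetrized_def star_prod_real[OF S h] regular_conj_regular[OF S h]
        regular_conj_real[OF S h])
  also have "\<dots> = of_real (r\<^sup>2 + s\<^sup>2)"
    using x by (simp add: heq rs quat_cnj_slice[OF M])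
      (simp add: of_real_def algebra_simps imag_sphere_square[OF M] power2_eq_square)
  finally show "symmetrized \<Omega> h (of_real x) = (h0 (of_real x))\<^sup>2 + (h1 (of_real x))\<^sup>2"
    by (simp add: rs)
qed

text \<open>One noncommutative equation becomes four equations between slice preserving functions,
  valid for oblique and perpendicular units alike. Three of them share \<open>f1\<close>. The
  numerical constants are attached to \<open>f1\<close>, so that the other factors are the divisors
  of the final statement.\<close>

lemma star_conjugation_adapted_iff:
  assumes S: "symmetric_slice_domain \<Omega>" and h: "h \<in> slice_regular \<Omega>"
    and h01: "h0 \<in> slice_preserving \<Omega>" "h1 \<in> slice_preserving \<Omega>"
    and heq: "\<forall>q\<in>\<Omega>. h q = h0 q + h1 q * M0" and M0: "M0 \<in> \<S>"
    and g: "g \<in> slice_regular \<Omega>" and dec: "slice_decomp \<Omega> I0 J0 K0 g g0 g1 g2 g3"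
    and I: "I0 \<in> \<S>" and K: "K0 \<in> \<S>" and orth: "inner K0 I0 = 0" and J: "J0 = K0 * I0"
    and M: "M0 = a *\<^sub>R I0 + b *\<^sub>R J0" and ab: "a\<^sup>2 + b\<^sup>2 = 1"
  shows "(\<exists>f\<in>one_slice_preserving \<Omega> I0.
           \<forall>q\<in>\<Omega>. g q = star_prod \<Omega> (star_prod \<Omega> h f) (regular_conj \<Omega> h) q) \<longleftrightarrow>
         (\<exists>f0\<in>slice_preserving \<Omega>. \<exists>f1\<in>slice_preserving \<Omega>. \<forall>q\<in>\<Omega>.
            g0 q = ((h0 q)\<^sup>2 + (h1 q)\<^sup>2) * f0 q \<and>
            g1 q = ((h0 q)\<^sup>2 + (2 * a\<^sup>2 - 1) *\<^sub>R (h1 q)\<^sup>2) * f1 q \<and>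
            g2 q = (h1 q)\<^sup>2 * ((2 * a * b) *\<^sub>R f1 q) \<and>
            g3 q = h0 q * h1 q * ((- 2 * b) *\<^sub>R f1 q))" (is "?L \<longleftrightarrow> ?R")
proof -
  have gp: "g0 \<in> slice_preserving \<Omega>" "g1 \<in> slice_preserving \<Omega>"
      "g2 \<in> slice_preserving \<Omega>" "g3 \<in> slice_preserving \<Omega>"
    and geq: "\<And>q. q \<in> \<Omega> \<Longrightarrow> g q = g0 q + g1 q * I0 + g2 q * J0 + g3 q * K0"
    using dec by (auto simp: slice_decomp_def)
  \<comment> \<open>With \<open>x\<close> fixed this is a comparison of real coefficients in an
    orthonormal basis. Being an equivalence, it serves both directions.\<close>
  have at_real: "g (of_real x) = star_prod \<Omega> (star_prod \<Omega> h f) (regular_conj \<Omega> h) (of_real x) \<longleftrightarrow>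
      g0 (of_real x) = ((h0 (of_real x))\<^sup>2 + (h1 (of_real x))\<^sup>2) * f0 (of_real x) \<and>
      g1 (of_real x) = ((h0 (of_real x))\<^sup>2 + (2 * a\<^sup>2 - 1) *\<^sub>R (h1 (of_real x))\<^sup>2) * f1 (of_real x) \<and>
      g2 (of_real x) = (h1 (of_real x))\<^sup>2 * ((2 * a * b) *\<^sub>R f1 (of_real x)) \<and>
      g3 (of_real x) = h0 (of_real x) * h1 (of_real x) * ((- 2 * b) *\<^sub>R f1 (of_real x))"
    if x: "of_real x \<in> \<Omega>" and f: "f \<in> slice_regular \<Omega>"
      and fp: "f0 \<in> slice_preserving \<Omega>" "f1 \<in> slice_preserving \<Omega>"
      and feq: "f (of_real x) = f0 (of_real x) + f1 (of_real x) * I0" for f f0 f1 x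
  proof -
    obtain r0 r1 r2 r3 where r: "g0 (of_real x) = of_real r0" "g1 (of_real x) = of_real r1"
      "g2 (of_real x) = of_real r2" "g3 (of_real x) = of_real r3"
      using gp[THEN slice_preserving_real, OF x] by metis
    obtain s0 s1 t0 t1 where st: "h0 (of_real x) = of_real s0" "h1 (of_real x) = of_real s1"
      "f0 (of_real x) = of_real t0" "f1 (of_real x) = of_real t1"
      using h01[THEN slice_preserving_real, OF x] fp[THEN slice_preserving_real, OF x] by metis
    have "star_prod \<Omega> (star_prod \<Omega> h f) (regular_conj \<Omega> h) (of_real x) =
        (of_real s0 + s1 *\<^sub>R M0) * (of_real t0 + t1 *\<^sub>R I0) * (of_real s0 - s1 *\<^sub>R M0)"
      using heq x by (simp add: star_conjugation_real[OF S h f x] st feq quat_cnj_slice[OF M0])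
        (simp add: of_real_def[of s1] of_real_def[of t1])
    note star = trans[OF this conjugation_in_adapted_basis[OF I K orth J M ab]]
    have "g (of_real x) = of_real r0 + r1 *\<^sub>R I0 + r2 *\<^sub>R J0 + r3 *\<^sub>R K0"
      by (simp add: geq[OF x] r) (simp add: of_real_def[of r1] of_real_def[of r2] of_real_def[of r3])
    then have "g (of_real x) = star_prod \<Omega> (star_prod \<Omega> h f) (regular_conj \<Omega> h) (of_real x) \<longleftrightarrow>
        r0 = (s0\<^sup>2 + s1\<^sup>2) * t0 \<and> r1 = (s0\<^sup>2 + (2 * a\<^sup>2 - 1) * s1\<^sup>2) * t1 \<and>
        r2 = 2 * a * b * s1\<^sup>2 * t1 \<and> r3 = - 2 * b * s0 * s1 * t1"
      unfolding star using orthogonal_units_coeffs[OF I K orth J] by metis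
    then show ?thesis
      unfolding r st
      by (simp add: quat_eq_iff quat_times_sel power2_eq_square) (simp add: algebra_simps)
  qed
  show ?thesis
  proof
    assume ?L
    then obtain f where f: "f \<in> one_slice_preserving \<Omega> I0"
      and gf: "\<And>q. q \<in> \<Omega> \<Longrightarrow> g q = star_prod \<Omega> (star_prod \<Omega> h f) (regular_conj \<Omega> h) q"
      by blast
    have freg: "f \<in> slice_regular \<Omega>"
      using f by (simp add: one_slice_preserving_def)
    obtain f0 f1 where fp: "f0 \<in> slice_preserving \<Omega>" "f1 \<in> slice_preserving \<Omega>"
      and "\<And>x. f (of_real x) \<in> \<C> I0 \<Longrightarrow> f (of_real x) = f0 (of_real x) + f1 (of_real x) * I0"
      using slice_regular_plane_components[OF S I freg] by blast
    then have feq: "\<And>x. of_real x \<in> \<Omega> \<Longrightarrow> f (of_real x) = f0 (of_real x) + f1 (of_real x) * I0"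
      using one_slice_preserving_real[OF f] by blast
    note eqs = iffD1[OF at_real[OF _ freg fp feq] gf]
    have "\<forall>q\<in>\<Omega>. g0 q = ((h0 q)\<^sup>2 + (h1 q)\<^sup>2) * f0 q"
      using eqs by (intro slice_preserving_eqI[OF S gp(1)] slice_preserving_intros fp h01) blast
    moreover have "\<forall>q\<in>\<Omega>. g1 q = ((h0 q)\<^sup>2 + (2 * a\<^sup>2 - 1) *\<^sub>R (h1 q)\<^sup>2) * f1 q"
      using eqs by (intro slice_preserving_eqI[OF S gp(2)] slice_preserving_intros fp h01) blast
    moreover have "\<forall>q\<in>\<Omega>. g2 q = (h1 q)\<^sup>2 * ((2 * a * b) *\<^sub>R f1 q)"
      using eqs by (intro slice_preserving_eqI[OF S gp(3)] slice_preserving_intros fp h01) blast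
    moreover have "\<forall>q\<in>\<Omega>. g3 q = h0 q * h1 q * ((- 2 * b) *\<^sub>R f1 q)"
      using eqs by (intro slice_preserving_eqI[OF S gp(4)] slice_preserving_intros fp h01) blast
    ultimately show ?R
      using fp by blast
  next
    assume ?R
    then obtain f0 f1 where fp: "f0 \<in> slice_preserving \<Omega>" "f1 \<in> slice_preserving \<Omega>"
      and eqs: "\<And>q. q \<in> \<Omega> \<Longrightarrow> g0 q = ((h0 q)\<^sup>2 + (h1 q)\<^sup>2) * f0 q \<and>
            g1 q = ((h0 q)\<^sup>2 + (2 * a\<^sup>2 - 1) *\<^sub>R (h1 q)\<^sup>2) * f1 q \<and>
            g2 q = (h1 q)\<^sup>2 * ((2 * a * b) *\<^sub>R f1 q) \<and>
            g3 q = h0 q * h1 q * ((- 2 * b) *\<^sub>R f1 q)"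
      by blast
    define f where "f q = f0 q + f1 q * I0" for q
    have f: "f \<in> one_slice_preserving \<Omega> I0"
      unfolding f_def by (rule one_slice_preservingI[OF I fp])
    then have freg: "f \<in> slice_regular \<Omega>"
      by (simp add: one_slice_preserving_def)
    have "g q = star_prod \<Omega> (star_prod \<Omega> h f) (regular_conj \<Omega> h) q" if "q \<in> \<Omega>" for q
      by (rule slice_regular_eqI_real[OF S g star_conjugation_regular[OF S h freg] _ that],
          rule iffD2[OF at_real[OF _ freg fp] eqs]) (simp_all add: f_def)
    with f show ?L by blast
  qed
qed

lemma slice_preserving_mult_cancel:
  assumes S: "symmetric_slice_domain \<Omega>" and p: "p \<in> slice_preserving \<Omega>"
    and f: "f \<in> slice_regular \<Omega>" and g: "g \<in> slice_regular \<Omega>"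
    and eq: "\<And>x. of_real x \<in> \<Omega> \<Longrightarrow> p (of_real x) * f (of_real x) = p (of_real x) * g (of_real x)"
    and x0: "of_real x0 \<in> \<Omega>" "p (of_real x0) \<noteq> 0"
    and q: "q \<in> \<Omega>"
  shows "f q = g q"
  using slice_regular_mult_eq_0[OF S slice_preserving_imp_regular[OF p] slice_regular_diff[OF f g] _ x0 q] eq
  by (simp add: right_diff_distrib)

section \<open>The three positions of the two imaginary units\<close>

text \<open>On the real axis \<open>h\<close> and \<open>f\<close> take values in one commutative
  plane, so conjugation by \<open>h\<close> is multiplication by the symmetrized function
  \<open>\<sigma>\<close>.\<close>

lemma star_conjugation_same_plane_iff:
  assumes S: "symmetric_slice_domain \<Omega>" and I: "I0 \<in> \<S>" and M: "M0 \<in> \<S>"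
    and planes: "\<C> M0 = \<C> I0" and h: "h \<in> one_slice_preserving \<Omega> M0"
    and h01: "h0 \<in> slice_preserving \<Omega>" "h1 \<in> slice_preserving \<Omega>"
    and heq: "\<forall>q\<in>\<Omega>. h q = h0 q + h1 q * M0"
    and x0: "of_real x0 \<in> \<Omega>" "h1 (of_real x0) \<noteq> 0"
    and g: "g \<in> slice_regular \<Omega>"
  shows "(\<exists>f\<in>one_slice_preserving \<Omega> I0.
           \<forall>q\<in>\<Omega>. g q = star_prod \<Omega> (star_prod \<Omega> h f) (regular_conj \<Omega> h) q) \<longleftrightarrow>
        g \<in> one_slice_preserving \<Omega> I0 \<and> divides_regular \<Omega> (symmetrized \<Omega> h) g"
    (is "?L \<longleftrightarrow> ?R")
proof -
  define \<sigma> where "\<sigma> q = (h0 q)\<^sup>2 + (h1 q)\<^sup>2" for q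
  have \<sigma>: "\<sigma> \<in> slice_preserving \<Omega>"
    unfolding \<sigma>_def by (intro slice_preserving_intros h01)
  have hreg: "h \<in> slice_regular \<Omega>"
    using h by (simp add: one_slice_preserving_def)
  have sym: "symmetrized \<Omega> h q = \<sigma> q" if "q \<in> \<Omega>" for q
    unfolding \<sigma>_def by (rule symmetrized_eq[OF S hreg M h01 heq that])
  have star: "star_prod \<Omega> (star_prod \<Omega> h f) (regular_conj \<Omega> h) q = \<sigma> q * f q"
    if f: "f \<in> one_slice_preserving \<Omega> I0" and q: "q \<in> \<Omega>" for f q
  proof (rule slice_regular_eqI_real[OF S _ _ _ q])
    have freg: "f \<in> slice_regular \<Omega>"
      using f by (simp add: one_slice_preserving_def)
    show "star_prod \<Omega> (star_prod \<Omega> h f) (regular_conj \<Omega> h) \<in> slice_regular \<Omega>"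
      by (rule star_conjugation_regular[OF S hreg freg])
    show "(\<lambda>q. \<sigma> q * f q) \<in> slice_regular \<Omega>"
      by (rule slice_regular_mult_preserving[OF \<sigma> freg])
    fix x :: real assume x: "of_real x \<in> \<Omega>"
    let ?h = "h (of_real x)" and ?f = "f (of_real x)"
    have "?h \<in> \<C> I0" "?f \<in> \<C> I0"
      using one_slice_preserving_real[OF h x] one_slice_preserving_real[OF f x] planes by auto
    then have "?h * ?f = ?f * ?h"
      unfolding slice_plane_eq using slice_emb_commute[OF I] by (metis imageE)
    then have "?h * ?f * quat_cnj ?h = ?f * (?h * quat_cnj ?h)"
      by (simp add: mult.assoc)
    \<comment> \<open>A quaternion times its conjugate is real, hence central.\<close>
    also have "\<dots> = ?h * quat_cnj ?h * ?f"
      by (simp add: quat_mult_cnj of_real_def)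
    also have "?h * quat_cnj ?h = symmetrized \<Omega> h (of_real x)"
      using x by (simp add: symmetrized_def star_prod_real[OF S hreg] regular_conj_regular[OF S hreg]
          regular_conj_real[OF S hreg])
    finally show "star_prod \<Omega> (star_prod \<Omega> h f) (regular_conj \<Omega> h) (of_real x) = \<sigma> (of_real x) * ?f"
      by (simp add: star_conjugation_real[OF S hreg freg x] sym[OF x])
  qed
  show ?thesis
  proof
    assume ?L
    then obtain f where f: "f \<in> one_slice_preserving \<Omega> I0" and gf: "\<And>q. q \<in> \<Omega> \<Longrightarrow> g q = \<sigma> q * f q"
      using star by auto
    have "g (slice_emb I0 z) \<in> \<C> I0" if z: "slice_emb I0 z \<in> \<Omega>" for z
      using f \<sigma> z I gf[OF z] unfolding one_slice_preserving_iff slice_preserving_iff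
      by (auto intro: slice_plane_mult)
    moreover have "f \<in> slice_regular \<Omega>"
      using f by (simp add: one_slice_preserving_def)
    ultimately show ?R
      using g gf sym by (auto simp: one_slice_preserving_iff divides_regular_def)
  next
    assume ?R
    then obtain k where gI: "g \<in> one_slice_preserving \<Omega> I0"
      and k: "k \<in> slice_regular \<Omega>" and gk: "\<And>q. q \<in> \<Omega> \<Longrightarrow> g q = \<sigma> q * k q"
      using sym by (auto simp: divides_regular_def)
    obtain k0 k1 where kp: "k0 \<in> slice_preserving \<Omega>" "k1 \<in> slice_preserving \<Omega>"
      and keq: "\<And>x. k (of_real x) \<in> \<C> I0 \<Longrightarrow> k (of_real x) = k0 (of_real x) + k1 (of_real x) * I0"
      using slice_regular_plane_components[OF S I k] by blast
    \<comment> \<open>The quotient \<open>k\<close> is replaced by its projection onto the plane of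
      \<open>I0\<close>. Where \<open>\<sigma>\<close> is nonzero on the real axis, \<open>k\<close>
      is a real multiple of \<open>g\<close> and already lies in that plane; where
      \<open>\<sigma>\<close> is zero, both products are zero.\<close>
    define f where "f q = k0 q + k1 q * I0" for q
    have f: "f \<in> one_slice_preserving \<Omega> I0"
      unfolding f_def by (rule one_slice_preservingI[OF I kp])
    have "\<sigma> (of_real x) * k (of_real x) = \<sigma> (of_real x) * f (of_real x)" if x: "of_real x \<in> \<Omega>" for x
    proof (cases "\<sigma> (of_real x) = 0")
      case False
      obtain r where r: "\<sigma> (of_real x) = of_real r"
        using slice_preserving_real[OF \<sigma> x] by blast
      with False have "k (of_real x) = (1 / r) *\<^sub>R g (of_real x)"
        by (simp add: gk[OF x]) (simp add: of_real_def[of r])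
      then have "k (of_real x) \<in> \<C> I0"
        using one_slice_preserving_real[OF gI x] by (simp add: slice_plane_scaleR)
      then show ?thesis
        unfolding f_def by (metis keq)
    qed simp
    then have "g q = \<sigma> q * f q" if q: "q \<in> \<Omega>" for q
      using f k q unfolding one_slice_preserving_iff
      by (intro slice_regular_eqI_real[OF S g slice_regular_mult_preserving[OF \<sigma>] _ q]) (auto simp: gk)
    with f star show ?L by auto
  qed
qed

section \<open>Divisibility and relations for oblique and perpendicular units\<close>

lemma divides_preservingI:
  "\<kappa> \<in> slice_preserving \<Omega> \<Longrightarrow> \<forall>q\<in>\<Omega>. p q = \<sigma> q * \<kappa> q \<Longrightarrow> divides_preserving \<Omega> \<sigma> p"
  by (auto simp: divides_preserving_def)

lemma divides_preserving_cong:
  "(\<And>q. q \<in> \<Omega> \<Longrightarrow> \<sigma> q = \<tau> q) \<Longrightarrow> divides_preserving \<Omega> \<sigma> p \<longleftrightarrow> divides_preserving \<Omega> \<tau> p"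
  by (simp add: divides_preserving_def)

text \<open>Since \<open>a\<close>, \<open>b\<close> are nonzero and \<open>h1\<close> is not
  identically zero, the quotient of \<open>g2\<close> by \<open>h1^2\<close> fixes
  \<open>f1\<close>. The two relations then force \<open>g1\<close> and \<open>g3\<close> to be
  built from the same \<open>f1\<close>.\<close>

lemma oblique_divisibility_iff:
  assumes S: "symmetric_slice_domain \<Omega>"
    and h01: "h0 \<in> slice_preserving \<Omega>" "h1 \<in> slice_preserving \<Omega>"
    and gp: "g0 \<in> slice_preserving \<Omega>" "g1 \<in> slice_preserving \<Omega>"
      "g2 \<in> slice_preserving \<Omega>" "g3 \<in> slice_preserving \<Omega>"
    and x0: "of_real x0 \<in> \<Omega>" "h1 (of_real x0) \<noteq> 0" and ab: "a \<noteq> 0" "b \<noteq> 0"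
  shows "(\<exists>f0\<in>slice_preserving \<Omega>. \<exists>f1\<in>slice_preserving \<Omega>. \<forall>q\<in>\<Omega>.
            g0 q = ((h0 q)\<^sup>2 + (h1 q)\<^sup>2) * f0 q \<and>
            g1 q = ((h0 q)\<^sup>2 + (2 * a\<^sup>2 - 1) *\<^sub>R (h1 q)\<^sup>2) * f1 q \<and>
            g2 q = (h1 q)\<^sup>2 * ((2 * a * b) *\<^sub>R f1 q) \<and>
            g3 q = h0 q * h1 q * ((- 2 * b) *\<^sub>R f1 q)) \<longleftrightarrow>
        divides_preserving \<Omega> (\<lambda>q. (h0 q)\<^sup>2 + (h1 q)\<^sup>2) g0 \<and>
        divides_preserving \<Omega> (\<lambda>q. (h0 q)\<^sup>2 + (2 * a\<^sup>2 - 1) *\<^sub>R (h1 q)\<^sup>2) g1 \<and>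
        divides_preserving \<Omega> (\<lambda>q. (h1 q)\<^sup>2) g2 \<and>
        divides_preserving \<Omega> (\<lambda>q. h0 q * h1 q) g3 \<and>
        (\<forall>q\<in>\<Omega>. h0 q * g2 q + a *\<^sub>R (h1 q * g3 q) = 0) \<and>
        (\<forall>q\<in>\<Omega>. ((h0 q)\<^sup>2 + (2 * a\<^sup>2 - 1) *\<^sub>R (h1 q)\<^sup>2) * g2 q
                  = (2 * a * b) *\<^sub>R ((h1 q)\<^sup>2 * g1 q))"
    (is "?L \<longleftrightarrow> ?R")
proof
  assume ?L
  then obtain f0 f1 where fp: "f0 \<in> slice_preserving \<Omega>" "f1 \<in> slice_preserving \<Omega>"
    and eqs: "\<forall>q\<in>\<Omega>. g0 q = ((h0 q)\<^sup>2 + (h1 q)\<^sup>2) * f0 q"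
      "\<forall>q\<in>\<Omega>. g1 q = ((h0 q)\<^sup>2 + (2 * a\<^sup>2 - 1) *\<^sub>R (h1 q)\<^sup>2) * f1 q"
      "\<forall>q\<in>\<Omega>. g2 q = (h1 q)\<^sup>2 * ((2 * a * b) *\<^sub>R f1 q)"
      "\<forall>q\<in>\<Omega>. g3 q = h0 q * h1 q * ((- 2 * b) *\<^sub>R f1 q)"
    by auto
  note f1s = slice_preserving_scaleR[OF fp(2)]
  have "\<forall>q\<in>\<Omega>. h0 q * g2 q + a *\<^sub>R (h1 q * g3 q) = 0"
  proof (rule slice_preserving_eqI[OF S])
    fix x :: real assume x: "of_real x \<in> \<Omega>"
    obtain s0 s1 t where "h0 (of_real x) = of_real s0" "h1 (of_real x) = of_real s1" "f1 (of_real x) = of_real t"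
      using h01[THEN slice_preserving_real, OF x] slice_preserving_real[OF fp(2) x] by metis
    then show "h0 (of_real x) * g2 (of_real x) + a *\<^sub>R (h1 (of_real x) * g3 (of_real x)) = 0"
      using x by (simp add: eqs quat_eq_iff quat_times_sel power2_eq_square)
  qed (intro slice_preserving_intros h01 gp)+
  moreover have "\<forall>q\<in>\<Omega>. ((h0 q)\<^sup>2 + (2 * a\<^sup>2 - 1) *\<^sub>R (h1 q)\<^sup>2) * g2 q
                  = (2 * a * b) *\<^sub>R ((h1 q)\<^sup>2 * g1 q)"
  proof (rule slice_preserving_eqI[OF S])
    fix x :: real assume x: "of_real x \<in> \<Omega>"
    obtain s0 s1 t where "h0 (of_real x) = of_real s0" "h1 (of_real x) = of_real s1" "f1 (of_real x) = of_real t"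
      using h01[THEN slice_preserving_real, OF x] slice_preserving_real[OF fp(2) x] by metis
    then show "((h0 (of_real x))\<^sup>2 + (2 * a\<^sup>2 - 1) *\<^sub>R (h1 (of_real x))\<^sup>2) * g2 (of_real x)
                  = (2 * a * b) *\<^sub>R ((h1 (of_real x))\<^sup>2 * g1 (of_real x))"
      using x by (simp add: eqs quat_eq_iff quat_times_sel power2_eq_square)
  qed (intro slice_preserving_intros h01 gp)+
  ultimately show ?R
    using divides_preservingI[OF fp(1) eqs(1)] divides_preservingI[OF fp(2) eqs(2)]
      divides_preservingI[OF f1s eqs(3)] divides_preservingI[OF f1s eqs(4)] by blast
next
  assume R: ?R
  then obtain f0 \<kappa> where f0: "f0 \<in> slice_preserving \<Omega>" "\<forall>q\<in>\<Omega>. g0 q = ((h0 q)\<^sup>2 + (h1 q)\<^sup>2) * f0 q"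
    and \<kappa>: "\<kappa> \<in> slice_preserving \<Omega>" "\<forall>q\<in>\<Omega>. g2 q = (h1 q)\<^sup>2 * \<kappa> q"
    unfolding divides_preserving_def by auto
  have rel: "\<forall>q\<in>\<Omega>. h0 q * g2 q + a *\<^sub>R (h1 q * g3 q) = 0"
    "\<forall>q\<in>\<Omega>. ((h0 q)\<^sup>2 + (2 * a\<^sup>2 - 1) *\<^sub>R (h1 q)\<^sup>2) * g2 q = (2 * a * b) *\<^sub>R ((h1 q)\<^sup>2 * g1 q)"
    using R by auto
  \<comment> \<open>The factor undoes the coefficient \<open>2 * a * b\<close> of the
    \<open>J0\<close> component.\<close>
  define f1 where "f1 q = (1 / (2 * a * b)) *\<^sub>R \<kappa> q" for q
  have f1: "f1 \<in> slice_preserving \<Omega>"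
    unfolding f1_def by (intro slice_preserving_intros \<kappa>)
  have \<kappa>_f1: "\<kappa> q = (2 * a * b) *\<^sub>R f1 q" for q
    using ab by (simp add: f1_def)
  have "g1 q = ((h0 q)\<^sup>2 + (2 * a\<^sup>2 - 1) *\<^sub>R (h1 q)\<^sup>2) * f1 q" if q: "q \<in> \<Omega>" for q
  \<comment> \<open>Divided by \<open>2 * a * b\<close>, the second relation is the claim multiplied
    by \<open>h1^2\<close>.\<close>
  proof (rule slice_preserving_mult_cancel[OF S slice_preserving_power2[OF h01(2)] _ _ _ x0(1) _ q])
    fix x :: real assume x: "of_real x \<in> \<Omega>"
    obtain s0 s1 t r where st: "h0 (of_real x) = of_real s0" "h1 (of_real x) = of_real s1"
        "f1 (of_real x) = of_real t" "g1 (of_real x) = of_real r"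
      using h01[THEN slice_preserving_real, OF x] slice_preserving_real[OF f1 x]
        slice_preserving_real[OF gp(2) x] by metis
    have "(2 * a * b) * ((s0\<^sup>2 + (2 * a\<^sup>2 - 1) * s1\<^sup>2) * (s1\<^sup>2 * t)) = (2 * a * b) * (s1\<^sup>2 * r)"
      using x bspec[OF rel(2) x] st
      by (simp add: \<kappa>(2) \<kappa>_f1 quat_eq_iff quat_times_sel power2_eq_square del: mult_cancel_left)
    then have "(s0\<^sup>2 + (2 * a\<^sup>2 - 1) * s1\<^sup>2) * (s1\<^sup>2 * t) = s1\<^sup>2 * r"
      by (rule mult_left_cancel[THEN iffD1, rotated]) (use ab in simp)
    then have "s1\<^sup>2 * r = s1\<^sup>2 * ((s0\<^sup>2 + (2 * a\<^sup>2 - 1) * s1\<^sup>2) * t)"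
      by (simp add: algebra_simps)
    then show "(h1 (of_real x))\<^sup>2 * g1 (of_real x) = (h1 (of_real x))\<^sup>2 *
        (((h0 (of_real x))\<^sup>2 + (2 * a\<^sup>2 - 1) *\<^sub>R (h1 (of_real x))\<^sup>2) * f1 (of_real x))"
      by (simp add: st quat_eq_iff quat_times_sel power2_eq_square)
  qed (use x0 in \<open>auto intro!: slice_preserving_imp_regular slice_preserving_intros h01 gp f1\<close>)
  moreover have "g3 q = h0 q * h1 q * ((- 2 * b) *\<^sub>R f1 q)" if q: "q \<in> \<Omega>" for q
  \<comment> \<open>Divided by \<open>a\<close>, the first relation is the claim multiplied by
    \<open>h1\<close>.\<close>
  proof (rule slice_preserving_mult_cancel[OF S h01(2) _ _ _ x0 q])
    fix x :: real assume x: "of_real x \<in> \<Omega>"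
    obtain s0 s1 t r where st: "h0 (of_real x) = of_real s0" "h1 (of_real x) = of_real s1"
        "f1 (of_real x) = of_real t" "g3 (of_real x) = of_real r"
      using h01[THEN slice_preserving_real, OF x] slice_preserving_real[OF f1 x]
        slice_preserving_real[OF gp(4) x] by metis
    have "a * (2 * b * s0 * s1 * s1 * t + s1 * r) = 0"
      using x bspec[OF rel(1) x] st by (simp add: \<kappa>(2) \<kappa>_f1 quat_eq_iff quat_times_sel power2_eq_square algebra_simps)
    then have "s1 * r = - (2 * b * s0 * s1 * s1 * t)"
      using ab by simp
    then show "h1 (of_real x) * g3 (of_real x) = h1 (of_real x) *
        (h0 (of_real x) * h1 (of_real x) * ((- 2 * b) *\<^sub>R f1 (of_real x)))"
      by (simp add: st quat_eq_iff quat_times_sel)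
  qed (intro slice_preserving_imp_regular slice_preserving_intros h01 gp f1)+
  ultimately show ?L
    using f0 f1 \<kappa>(2) \<kappa>_f1 by auto
qed

text \<open>Now \<open>g2\<close> carries no information on \<open>f1\<close>. The quotients
  \<open>\<kappa>\<close> of \<open>g1\<close> and \<open>\<mu>\<close> of \<open>g3\<close> are two
  candidates for \<open>f1\<close> and \<open>- 2\<close> times \<open>f1\<close>. The relation says
  that \<open>h0 * h1 * (h0^2 - h1^2)\<close> annihilates \<open>2 * \<kappa> + \<mu>\<close>, so
  the candidates agree unless one of the factors \<open>h0 * h1\<close> and
  \<open>h0^2 - h1^2\<close> is identically zero.\<close>

lemma perpendicular_divisibility_iff:
  assumes S: "symmetric_slice_domain \<Omega>"
    and h01: "h0 \<in> slice_preserving \<Omega>" "h1 \<in> slice_preserving \<Omega>"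
    and gp: "g0 \<in> slice_preserving \<Omega>" "g1 \<in> slice_preserving \<Omega>" "g3 \<in> slice_preserving \<Omega>"
  shows "(\<exists>f0\<in>slice_preserving \<Omega>. \<exists>f1\<in>slice_preserving \<Omega>. \<forall>q\<in>\<Omega>.
            g0 q = ((h0 q)\<^sup>2 + (h1 q)\<^sup>2) * f0 q \<and>
            g1 q = ((h0 q)\<^sup>2 - (h1 q)\<^sup>2) * f1 q \<and> g2 q = 0 \<and>
            g3 q = h0 q * h1 q * ((- 2) *\<^sub>R f1 q)) \<longleftrightarrow>
        divides_preserving \<Omega> (\<lambda>q. (h0 q)\<^sup>2 + (h1 q)\<^sup>2) g0 \<and>
        divides_preserving \<Omega> (\<lambda>q. (h0 q)\<^sup>2 - (h1 q)\<^sup>2) g1 \<and>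
        divides_preserving \<Omega> (\<lambda>q. h0 q * h1 q) g3 \<and>
        (\<forall>q\<in>\<Omega>. g2 q = 0) \<and>
        (\<forall>q\<in>\<Omega>. 2 * h0 q * h1 q * g1 q + ((h0 q)\<^sup>2 - (h1 q)\<^sup>2) * g3 q = 0)"
    (is "?L \<longleftrightarrow> ?R")
proof
  assume ?L
  then obtain f0 f1 where fp: "f0 \<in> slice_preserving \<Omega>" "f1 \<in> slice_preserving \<Omega>"
    and eqs: "\<forall>q\<in>\<Omega>. g0 q = ((h0 q)\<^sup>2 + (h1 q)\<^sup>2) * f0 q"
      "\<forall>q\<in>\<Omega>. g1 q = ((h0 q)\<^sup>2 - (h1 q)\<^sup>2) * f1 q" "\<forall>q\<in>\<Omega>. g2 q = 0"
      "\<forall>q\<in>\<Omega>. g3 q = h0 q * h1 q * ((- 2) *\<^sub>R f1 q)"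
    by auto
  have "\<forall>q\<in>\<Omega>. 2 *\<^sub>R (h0 q * h1 q * g1 q) + ((h0 q)\<^sup>2 - (h1 q)\<^sup>2) * g3 q = 0"
  proof (rule slice_preserving_eqI[OF S])
    fix x :: real assume x: "of_real x \<in> \<Omega>"
    obtain s0 s1 t where "h0 (of_real x) = of_real s0" "h1 (of_real x) = of_real s1" "f1 (of_real x) = of_real t"
      using h01[THEN slice_preserving_real, OF x] slice_preserving_real[OF fp(2) x] by metis
    then show "2 *\<^sub>R (h0 (of_real x) * h1 (of_real x) * g1 (of_real x)) +
        ((h0 (of_real x))\<^sup>2 - (h1 (of_real x))\<^sup>2) * g3 (of_real x) = 0"
      using x by (simp add: eqs quat_eq_iff quat_times_sel power2_eq_square)
  qed (intro slice_preserving_intros h01 gp)+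
  \<comment> \<open>The numeral in the statement is the quaternion 2; the closure rules are stated
    for real scaling, hence the detour.\<close>
  then have "\<forall>q\<in>\<Omega>. 2 * h0 q * h1 q * g1 q + ((h0 q)\<^sup>2 - (h1 q)\<^sup>2) * g3 q = 0"
    by (simp add: scaleR_2 mult_2 distrib_right)
  then show ?R
    using divides_preservingI[OF fp(1) eqs(1)] divides_preservingI[OF fp(2) eqs(2)] eqs(3)
      divides_preservingI[OF slice_preserving_scaleR[OF fp(2)] eqs(4)] by blast
next
  assume R: ?R
  then obtain f0 \<kappa> \<mu> where f0: "f0 \<in> slice_preserving \<Omega>" "\<forall>q\<in>\<Omega>. g0 q = ((h0 q)\<^sup>2 + (h1 q)\<^sup>2) * f0 q"
    and \<kappa>: "\<kappa> \<in> slice_preserving \<Omega>" "\<forall>q\<in>\<Omega>. g1 q = ((h0 q)\<^sup>2 - (h1 q)\<^sup>2) * \<kappa> q"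
    and \<mu>: "\<mu> \<in> slice_preserving \<Omega>" "\<forall>q\<in>\<Omega>. g3 q = h0 q * h1 q * \<mu> q"
    unfolding divides_preserving_def by auto
  have g2: "\<forall>q\<in>\<Omega>. g2 q = 0"
    and rel: "\<forall>q\<in>\<Omega>. 2 * h0 q * h1 q * g1 q + ((h0 q)\<^sup>2 - (h1 q)\<^sup>2) * g3 q = 0"
    using R by auto
  define A B where "A q = h0 q * h1 q" and "B q = (h0 q)\<^sup>2 - (h1 q)\<^sup>2" for q
  have AB: "A \<in> slice_preserving \<Omega>" "B \<in> slice_preserving \<Omega>"
    unfolding A_def B_def by (intro slice_preserving_intros h01)+
  have AB_rel: "A (of_real x) * (B (of_real x) * (2 *\<^sub>R \<kappa> (of_real x) + \<mu> (of_real x))) = 0"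
    if x: "of_real x \<in> \<Omega>" for x
  proof -
    obtain s0 s1 t u where "h0 (of_real x) = of_real s0" "h1 (of_real x) = of_real s1"
        "\<kappa> (of_real x) = of_real t" "\<mu> (of_real x) = of_real u"
      using h01[THEN slice_preserving_real, OF x] slice_preserving_real[OF \<kappa>(1) x]
        slice_preserving_real[OF \<mu>(1) x] by metis
    then show ?thesis
      using x bspec[OF rel x]
      by (simp add: A_def B_def \<kappa>(2) \<mu>(2) quat_eq_iff quat_times_sel power2_eq_square algebra_simps)
  qed
  have reg: "A \<in> slice_regular \<Omega>" "B \<in> slice_regular \<Omega>"
    "(\<lambda>q. 2 *\<^sub>R \<kappa> q + \<mu> q) \<in> slice_regular \<Omega>"
    "(\<lambda>q. B q * (2 *\<^sub>R \<kappa> q + \<mu> q)) \<in> slice_regular \<Omega>"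
    by (intro slice_preserving_imp_regular slice_preserving_intros AB \<kappa> \<mu>)+
  \<comment> \<open>If \<open>A\<close> vanishes, the equation for \<open>g3\<close> is void and
    \<open>\<kappa>\<close> works. If \<open>B\<close> vanishes, the equation for \<open>g1\<close>
    is void and \<open>- \<mu> / 2\<close> works. Otherwise both factors cancel and the two
    candidates coincide.\<close>
  have "\<exists>f1\<in>slice_preserving \<Omega>. \<forall>q\<in>\<Omega>. B q * \<kappa> q = B q * f1 q \<and> A q * \<mu> q = A q * ((- 2) *\<^sub>R f1 q)"
  proof (cases "\<forall>x. of_real x \<in> \<Omega> \<longrightarrow> A (of_real x) = 0")
    case True
    then have "\<forall>q\<in>\<Omega>. A q = 0"
      by (intro slice_preserving_eqI[OF S AB(1) slice_preserving_zero]) auto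
    then show ?thesis
      using \<kappa>(1) by auto
  next
    case False
    then have B: "\<And>q. q \<in> \<Omega> \<Longrightarrow> B q * (2 *\<^sub>R \<kappa> q + \<mu> q) = 0"
      using slice_regular_mult_eq_0[OF S reg(1,4) AB_rel] by blast
    show ?thesis
    proof (cases "\<forall>x. of_real x \<in> \<Omega> \<longrightarrow> B (of_real x) = 0")
      case True
      then have "\<forall>q\<in>\<Omega>. B q = 0"
        by (intro slice_preserving_eqI[OF S AB(2) slice_preserving_zero]) auto
      then show ?thesis
        using slice_preserving_scaleR[OF \<mu>(1), of "- 1 / 2"] by (intro bexI) auto
    next
      case False
      then have "\<And>q. q \<in> \<Omega> \<Longrightarrow> 2 *\<^sub>R \<kappa> q + \<mu> q = 0"
        using slice_regular_mult_eq_0[OF S reg(2,3) B] by blast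
      then have "\<And>q. q \<in> \<Omega> \<Longrightarrow> \<mu> q = (- 2) *\<^sub>R \<kappa> q"
        by (metis add.inverse_unique scaleR_minus_left)
      then show ?thesis
        using \<kappa>(1) by auto
    qed
  qed
  then show ?L
    unfolding A_def B_def using f0 g2 \<kappa>(2) \<mu>(2) by metis
qed

text \<open>Dependent unit vectors differ by a sign, and opposite units span the same plane by
  conjugation of the coordinate. Equality of the units is listed separately because the set
  \<open>{I, M}\<close> is then a singleton, which is independent.\<close>

lemma slice_plane_eq_if_dependent:
  assumes I: "I \<in> \<S>" and M: "M \<in> \<S>" and dep: "\<not> (I \<noteq> M \<and> independent {I, M})"
  shows "\<C> M = \<C> I"
proof (cases "I = M")
  case False
  have "M \<noteq> 0"
    using norm_imag_sphere[OF M] by auto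
  then have "I \<in> span {M}"
    using dep False by (auto simp: independent_insert)
  then obtain c where c: "I = c *\<^sub>R M"
    by (auto simp: span_singleton)
  then have "\<bar>c\<bar> = 1"
    using norm_imag_sphere[OF I] norm_imag_sphere[OF M] by simp
  with c False have "I = - M"
    by (auto simp: abs_if split: if_splits)
  then have "slice_emb I = slice_emb M \<circ> cnj"
    by (simp add: slice_emb_cnj fun_eq_iff)
  then have "range (slice_emb I) = slice_emb M ` range cnj"
    by (simp add: image_comp)
  also have "range cnj = UNIV"
    by (metis complex_cnj_cnj surjI)
  finally show ?thesis
    by (simp add: slice_plane_eq)
qed simp

theorem proposition5p11:
  fixes \<Omega> :: "quat set"
    and I0 M0 J0 K0 :: quat
    and a b :: real
    and h h0 h1 g g0 g1 g2 g3 :: "quat \<Rightarrow> quat"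
  assumes "symmetric_slice_domain \<Omega>"
    and "\<exists>I\<in>\<S>. simply_connected (\<Omega> \<inter> \<C> I)"
    and "I0 \<in> \<S>" and "M0 \<in> \<S>"
    and "h \<in> one_slice_preserving \<Omega> M0 - slice_preserving \<Omega>"
    and "h0 \<in> slice_preserving \<Omega>" and "h1 \<in> slice_preserving \<Omega>"
    and "\<forall>q\<in>\<Omega>. h q = h0 q + h1 q * M0"
    and "g \<in> slice_regular \<Omega>"
    and "I0 \<noteq> M0 \<and> independent {I0, M0} \<Longrightarrow>
           K0 = (I0 \<and>\<^sub>H M0) /\<^sub>R norm (I0 \<and>\<^sub>H M0) \<and>
           J0 = K0 * I0 \<and>
           M0 = a *\<^sub>R I0 + b *\<^sub>R J0 \<and> b > 0 \<and> a\<^sup>2 + b\<^sup>2 = 1 \<and>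
           slice_decomp \<Omega> I0 J0 K0 g g0 g1 g2 g3"
  shows
    "(\<C> M0 = \<C> I0 \<longrightarrow>
       ((\<exists>f\<in>one_slice_preserving \<Omega> I0.
           \<forall>q\<in>\<Omega>. g q = star_prod \<Omega> (star_prod \<Omega> h f) (regular_conj \<Omega> h) q) \<longleftrightarrow>
        g \<in> one_slice_preserving \<Omega> I0 \<and> divides_regular \<Omega> (symmetrized \<Omega> h) g)) \<and>
     (\<C> M0 \<noteq> \<C> I0 \<and> \<not> orthogonal M0 I0 \<longrightarrow>
       ((\<exists>f\<in>one_slice_preserving \<Omega> I0.
           \<forall>q\<in>\<Omega>. g q = star_prod \<Omega> (star_prod \<Omega> h f) (regular_conj \<Omega> h) q) \<longleftrightarrow>
        divides_preserving \<Omega> (symmetrized \<Omega> h) g0 \<and>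
        divides_preserving \<Omega> (\<lambda>q. (h0 q)\<^sup>2 + (2 * a\<^sup>2 - 1) *\<^sub>R (h1 q)\<^sup>2) g1 \<and>
        divides_preserving \<Omega> (\<lambda>q. (h1 q)\<^sup>2) g2 \<and>
        divides_preserving \<Omega> (\<lambda>q. h0 q * h1 q) g3 \<and>
        (\<forall>q\<in>\<Omega>. h0 q * g2 q + a *\<^sub>R (h1 q * g3 q) = 0) \<and>
        (\<forall>q\<in>\<Omega>. ((h0 q)\<^sup>2 + (2 * a\<^sup>2 - 1) *\<^sub>R (h1 q)\<^sup>2) * g2 q
                  = (2 * a * b) *\<^sub>R ((h1 q)\<^sup>2 * g1 q)))) \<and>
     (orthogonal M0 I0 \<longrightarrow>
       ((\<exists>f\<in>one_slice_preserving \<Omega> I0.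
           \<forall>q\<in>\<Omega>. g q = star_prod \<Omega> (star_prod \<Omega> h f) (regular_conj \<Omega> h) q) \<longleftrightarrow>
        divides_preserving \<Omega> (symmetrized \<Omega> h) g0 \<and>
        divides_preserving \<Omega> (\<lambda>q. (h0 q)\<^sup>2 - (h1 q)\<^sup>2) g1 \<and>
        divides_preserving \<Omega> (\<lambda>q. h0 q * h1 q) g3 \<and>
        (\<forall>q\<in>\<Omega>. g2 q = 0) \<and>
        (\<forall>q\<in>\<Omega>. 2 * h0 q * h1 q * g1 q + ((h0 q)\<^sup>2 - (h1 q)\<^sup>2) * g3 q = 0)))"
proof -
  note S = assms(1) and I = assms(3) and M = assms(4) and h01 = assms(6,7) and heq = assms(8)
    and g = assms(9)
  have h: "h \<in> one_slice_preserving \<Omega> M0" and hnp: "h \<notin> slice_preserving \<Omega>"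
    using assms(5) by auto
  have hreg: "h \<in> slice_regular \<Omega>"
    using h by (simp add: one_slice_preserving_def)
  \<comment> \<open>Otherwise \<open>h1\<close> would vanish on the whole domain and
    \<open>h = h0\<close> would be slice preserving.\<close>
  have "\<exists>x. of_real x \<in> \<Omega> \<and> h1 (of_real x) \<noteq> 0"
  proof (rule ccontr)
    assume "\<nexists>x. of_real x \<in> \<Omega> \<and> h1 (of_real x) \<noteq> 0"
    then have "\<forall>q\<in>\<Omega>. h1 q = 0"
      by (intro slice_preserving_eqI[OF S h01(2) slice_preserving_zero]) auto
    then have "h \<in> slice_preserving \<Omega>"
      using heq by (intro slice_preserving_cong[OF S h01(1)]) auto
    with hnp show False ..
  qed
  then obtain x0 where x0: "of_real x0 \<in> \<Omega>" "h1 (of_real x0) \<noteq> 0"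
    by blast
  have sym: "divides_preserving \<Omega> (symmetrized \<Omega> h) p \<longleftrightarrow>
      divides_preserving \<Omega> (\<lambda>q. (h0 q)\<^sup>2 + (h1 q)\<^sup>2) p" for p
    by (rule divides_preserving_cong) (rule symmetrized_eq[OF S hreg M h01 heq])
  have adapted: "b > 0 \<and> a\<^sup>2 + b\<^sup>2 = 1 \<and> inner M0 I0 = a \<and> slice_decomp \<Omega> I0 J0 K0 g g0 g1 g2 g3 \<and>
      ((\<exists>f\<in>one_slice_preserving \<Omega> I0.
           \<forall>q\<in>\<Omega>. g q = star_prod \<Omega> (star_prod \<Omega> h f) (regular_conj \<Omega> h) q) \<longleftrightarrow>
         (\<exists>f0\<in>slice_preserving \<Omega>. \<exists>f1\<in>slice_preserving \<Omega>. \<forall>q\<in>\<Omega>.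
            g0 q = ((h0 q)\<^sup>2 + (h1 q)\<^sup>2) * f0 q \<and>
            g1 q = ((h0 q)\<^sup>2 + (2 * a\<^sup>2 - 1) *\<^sub>R (h1 q)\<^sup>2) * f1 q \<and>
            g2 q = (h1 q)\<^sup>2 * ((2 * a * b) *\<^sub>R f1 q) \<and>
            g3 q = h0 q * h1 q * ((- 2 * b) *\<^sub>R f1 q)))"
    if ind: "I0 \<noteq> M0 \<and> independent {I0, M0}"
  proof -
    from assms(10)[OF ind] have K: "K0 = (I0 \<and>\<^sub>H M0) /\<^sub>R norm (I0 \<and>\<^sub>H M0)" and J: "J0 = K0 * I0"
      and M0: "M0 = a *\<^sub>R I0 + b *\<^sub>R J0" and b: "b > 0" and ab: "a\<^sup>2 + b\<^sup>2 = 1"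
      and dec: "slice_decomp \<Omega> I0 J0 K0 g g0 g1 g2 g3"
      by blast+
    note K' = adapted_K0[OF I M K J M0 b ab] and orth = adapted_inner[OF I M K J M0 b ab]
    have "inner I0 I0 = 1" "inner J0 I0 = 0"
      using norm_imag_sphere[OF I] orthogonal_units_inner(1)[OF I K' orth J]
      by (simp_all add: norm_eq_1 inner_commute)
    \<comment> \<open>This turns orthogonality of \<open>M0\<close> and \<open>I0\<close> into
      \<open>a = 0\<close>, which separates the oblique from the perpendicular case.\<close>
    then have "inner M0 I0 = a"
      by (subst M0) (simp add: inner_add_left)
    with b ab dec star_conjugation_adapted_iff[OF S hreg h01 heq M g dec I K' orth J M0 ab]
    show ?thesis by blast
  qed
  have oblique: "(\<exists>f\<in>one_slice_preserving \<Omega> I0.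
           \<forall>q\<in>\<Omega>. g q = star_prod \<Omega> (star_prod \<Omega> h f) (regular_conj \<Omega> h) q) \<longleftrightarrow>
        divides_preserving \<Omega> (symmetrized \<Omega> h) g0 \<and>
        divides_preserving \<Omega> (\<lambda>q. (h0 q)\<^sup>2 + (2 * a\<^sup>2 - 1) *\<^sub>R (h1 q)\<^sup>2) g1 \<and>
        divides_preserving \<Omega> (\<lambda>q. (h1 q)\<^sup>2) g2 \<and>
        divides_preserving \<Omega> (\<lambda>q. h0 q * h1 q) g3 \<and>
        (\<forall>q\<in>\<Omega>. h0 q * g2 q + a *\<^sub>R (h1 q * g3 q) = 0) \<and>
        (\<forall>q\<in>\<Omega>. ((h0 q)\<^sup>2 + (2 * a\<^sup>2 - 1) *\<^sub>R (h1 q)\<^sup>2) * g2 q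
                  = (2 * a * b) *\<^sub>R ((h1 q)\<^sup>2 * g1 q))"
    if "\<C> M0 \<noteq> \<C> I0" "\<not> orthogonal M0 I0"
  proof -
    have "I0 \<noteq> M0 \<and> independent {I0, M0}"
      using that(1) slice_plane_eq_if_dependent[OF I M] by blast
    note ad = adapted[OF this]
    have gp: "g0 \<in> slice_preserving \<Omega>" "g1 \<in> slice_preserving \<Omega>"
      "g2 \<in> slice_preserving \<Omega>" "g3 \<in> slice_preserving \<Omega>"
      using ad by (auto simp: slice_decomp_def)
    have "a \<noteq> 0" "b \<noteq> 0"
      using ad that(2) by (auto simp: orthogonal_def)
    from oblique_divisibility_iff[OF S h01 gp x0 this] show ?thesis
      unfolding sym using ad by (simp only:)
  qed
  have perpendicular: "(\<exists>f\<in>one_slice_preserving \<Omega> I0.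
           \<forall>q\<in>\<Omega>. g q = star_prod \<Omega> (star_prod \<Omega> h f) (regular_conj \<Omega> h) q) \<longleftrightarrow>
        divides_preserving \<Omega> (symmetrized \<Omega> h) g0 \<and>
        divides_preserving \<Omega> (\<lambda>q. (h0 q)\<^sup>2 - (h1 q)\<^sup>2) g1 \<and>
        divides_preserving \<Omega> (\<lambda>q. h0 q * h1 q) g3 \<and>
        (\<forall>q\<in>\<Omega>. g2 q = 0) \<and>
        (\<forall>q\<in>\<Omega>. 2 * h0 q * h1 q * g1 q + ((h0 q)\<^sup>2 - (h1 q)\<^sup>2) * g3 q = 0)"
    if orth: "orthogonal M0 I0"
  proof -
    have "I0 \<noteq> 0" "M0 \<noteq> 0"
      using norm_imag_sphere[OF I] norm_imag_sphere[OF M] by auto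
    then have "I0 \<noteq> M0"
      using orth by (auto simp: orthogonal_def)
    moreover have "independent {I0, M0}"
      using orth \<open>I0 \<noteq> 0\<close> \<open>M0 \<noteq> 0\<close>
      by (intro pairwise_orthogonal_independent) (auto simp: pairwise_def orthogonal_commute)
    ultimately have "I0 \<noteq> M0 \<and> independent {I0, M0}" ..
    note ad = adapted[OF this]
    have gp: "g0 \<in> slice_preserving \<Omega>" "g1 \<in> slice_preserving \<Omega>" "g3 \<in> slice_preserving \<Omega>"
      using ad by (auto simp: slice_decomp_def)
    have a: "a = 0"
      using ad orth by (simp add: orthogonal_def)
    \<comment> \<open>The sign of \<open>b\<close> excludes -1. The general coefficients
      \<open>2 * a\<^sup>2 - 1\<close>, \<open>2 * a * b\<close> and \<open>- 2 * b\<close> now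
      become -1, 0 and -2.\<close>
    then have "b = 1"
      using ad by (auto simp: power2_eq_1_iff)
    then show ?thesis
      unfolding sym perpendicular_divisibility_iff[OF S h01 gp, symmetric]
      using ad a by simp
  qed
  from star_conjugation_same_plane_iff[OF S I M _ h h01 heq x0 g] oblique perpendicular
  show ?thesis by blast
qed

end
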